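(* Let $n\ge 2$, let $\mathcal{H}_1,\dots,\mathcal{H}_n$ be infinite dimensional complex Hilbert spaces, and let $D_s\in\mathcal{B}(\mathcal{H}_s)$ for $1\le s\le n$. Consider the following statements. (i) Both of the following hold: (a) $D_n\in\Phi_-(\mathcal{H}_n)$; (b) either [$\mathcal{R}(D_s)$ is closed for $1\le s\le n-1$, $\beta(D_s)\le\alpha(D_{s+1})$ for $1\le s\le n-1$, and $\sum_{s=1}^n\alpha(D_s)=\infty$], or [$D_s\in\Phi_-(\mathcal{H}_s)$ for $1\le s\le n-1$ and $\sum_{s=1}^n\beta(D_s)\le\sum_{s=1}^n\alpha(D_s)$]. (ii) There exists $A\in\mathcal{B}_n$ such that $T_n^d(A)\in\Phi_-^+(\mathcal{H}_1\oplus\cdots\oplus\mathcal{H}_n)$. (iii) Both of the following hold: (a) $D_n\in\Phi_-(\mathcal{H}_n)$; (b) either [there is $j\in\{2,\dots,n\}$ such that $\alpha(D_j)=\infty$ and $\beta(D_s)<\infty$ for $j\le s\le n-1$ (the last condition being omitted if $j=n$)], or [$D_s\in\Phi_-(\mathcal{H}_s)$ for $1\le s\le n-1$ and $\sum_{s=1}^n\beta(D_s)\le\sum_{s=1}^n\alpha(D_s)$]. Then (i) $\Rightarrow$ (ii) $\Rightarrow$ (iii).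
   Context: $\mathcal{B}(\mathcal{H},\mathcal{K})$ is the space of bounded linear operators from $\mathcal{H}$ to $\mathcal{K}$, and $\mathcal{B}(\mathcal{H})=\mathcal{B}(\mathcal{H},\mathcal{H})$. $\mathcal{N}(T)$ and $\mathcal{R}(T)$ are the kernel and range of $T$. $\mathcal{B}_n$ is the set of all tuples $A=(A_{ij})_{1\le i<j\le n}$ with $A_{ij}\in\mathcal{B}(\mathcal{H}_j,\mathcal{H}_i)$. Given $D_1,\dots,D_n$ and $A\in\mathcal{B}_n$, $T_n^d(A)\in\mathcal{B}(\mathcal{H}_1\oplus\cdots\oplus\mathcal{H}_n)$ is the upper triangular block operator matrix with diagonal entries $D_1,\dots,D_n$, entry $A_{ij}$ in position $(i,j)$ for $i<j$, and $0$ in position $(i,j)$ for $i>j$. For $T\in\mathcal{B}(\mathcal{H})$: $\alpha(T)=\dim\mathcal{N}(T)$ and $\beta(T)=\dim\mathcal{H}/\mathcal{R}(T)$. Dimensions of Hilbert spaces are Hilbert (orthogonal) dimensions, compared as cardinals; thus $\beta(T)$ is the Hilbert dimension of $\mathcal{R}(T)^\perp$ if $\mathcal{R}(T)$ is closed, while if $\mathcal{R}(T)$ is not closed $\beta(T)$ is the algebraic dimension of the quotient, which is infinite. "$=\infty$" means infinite and "$<\infty$" means finite. If at least one of $\alpha(T),\beta(T)$ is finite, $\mathrm{ind}(T)=\alpha(T)-\beta(T)$ (equal to $-\infty$ if only $\beta(T)$ is infinite, $+\infty$ if only $\alpha(T)$ is infinite). $\Phi_-(\mathcal{H})=\{T\in\mathcal{B}(\mathcal{H}):\beta(T)<\infty\}$;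 $\Phi_-^+(\mathcal{H})=\{T\in\Phi_-(\mathcal{H}):\mathrm{ind}(T)\ge 0\}$. *)

theory Defs
  imports "HOL-Analysis.Analysis" "HOL-Library.Extended_Real"
begin

unbundle cardinal_syntax

section \<open>Complex Hilbert spaces\<close>

text \<open>
  The distribution only has real inner product spaces. A complex one is a real one together with
  a complex scalar multiplication and a complex inner product (linear in the first argument)
  whose real part is the given real inner product; so norm, topology and completeness are
  the library's, and positive definiteness is inherited.
\<close>

class complex_inner = real_inner +
  fixes scaleC :: "complex \<Rightarrow> 'a \<Rightarrow> 'a"  (infixr "*\<^sub>C" 75)
    and cinner :: "'a \<Rightarrow> 'a \<Rightarrow> complex"
  assumes scaleC_add_right: "c *\<^sub>C (x + y) = c *\<^sub>C x + c *\<^sub>C y"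
    and scaleC_add_left: "(c + d) *\<^sub>C x = c *\<^sub>C x + d *\<^sub>C x"
    and scaleC_scaleC: "c *\<^sub>C (d *\<^sub>C x) = (c * d) *\<^sub>C x"
    and scaleC_one: "1 *\<^sub>C x = x"
    and scaleR_scaleC: "scaleR r x = complex_of_real r *\<^sub>C x"
    and cinner_commute: "cinner x y = cnj (cinner y x)"
    and cinner_add_left: "cinner (x + y) z = cinner x z + cinner y z"
    and cinner_scaleC_left: "cinner (c *\<^sub>C x) y = c * cinner x y"
    and inner_eq_Re_cinner: "inner x y = Re (cinner x y)"

class chilbert_space = complex_inner + complete_space

global_interpretation complex_vector: vector_space "scaleC :: complex \<Rightarrow> 'a \<Rightarrow> 'a::complex_inner"
  defines csubspace = complex_vector.subspace
    and cspan = complex_vector.span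
  by unfold_locales (simp_all add: scaleC_add_right scaleC_add_left scaleC_scaleC scaleC_one)

instantiation vec :: (complex_inner, finite) complex_inner
begin

definition "scaleC c x = (\<chi> i. c *\<^sub>C (x $ i))"

definition "cinner x y = (\<Sum>i\<in>UNIV. cinner (x $ i) (y $ i))"

instance
proof
  fix c d :: complex and r :: real and x y z :: "('a, 'b) vec"
  show "c *\<^sub>C (x + y) = c *\<^sub>C x + c *\<^sub>C y"
    by (simp add: scaleC_vec_def vec_eq_iff scaleC_add_right)
  show "(c + d) *\<^sub>C x = c *\<^sub>C x + d *\<^sub>C x"
    by (simp add: scaleC_vec_def vec_eq_iff scaleC_add_left)
  show "c *\<^sub>C (d *\<^sub>C x) = (c * d) *\<^sub>C x"
    by (simp add: scaleC_vec_def vec_eq_iff scaleC_scaleC)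
  show "1 *\<^sub>C x = x"
    by (simp add: scaleC_vec_def vec_eq_iff scaleC_one)
  show "scaleR r x = complex_of_real r *\<^sub>C x"
    by (simp add: scaleC_vec_def vec_eq_iff scaleR_scaleC)
  show "cinner x y = cnj (cinner y x)"
    unfolding cinner_vec_def cnj_sum by (rule sum.cong[OF refl]) (rule cinner_commute)
  show "cinner (x + y) z = cinner x z + cinner y z"
    by (simp add: cinner_vec_def cinner_add_left sum.distrib)
  show "cinner (c *\<^sub>C x) y = c * cinner x y"
    by (simp add: cinner_vec_def scaleC_vec_def cinner_scaleC_left sum_distrib_left)
  show "inner x y = Re (cinner x y)"
    by (simp add: cinner_vec_def inner_vec_def inner_eq_Re_cinner)
qed

end

instance vec :: (chilbert_space, finite) chilbert_space ..

text \<open>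
  A Hilbert space is represented by a closed complex subspace of an arbitrary Hilbert space type.
  The ambient type only provides a common home for spaces of different dimensions: any family of
  Hilbert spaces embeds isometrically into its Hilbert sum.
\<close>

definition hilbert :: "'a::chilbert_space set \<Rightarrow> bool" where
  "hilbert H \<longleftrightarrow> csubspace H \<and> closed H"

text \<open>The values of an operator outside its domain \<open>H\<close> are irrelevant throughout.\<close>

definition bounded_ops :: "'a::chilbert_space set \<Rightarrow> 'b::chilbert_space set \<Rightarrow> ('a \<Rightarrow> 'b) set" where
  "bounded_ops H K = {T.
     (\<forall>x\<in>H. T x \<in> K) \<and>
     (\<forall>x\<in>H. \<forall>y\<in>H. T (x + y) = T x + T y) \<and>
     (\<forall>c. \<forall>x\<in>H. T (c *\<^sub>C x) = c *\<^sub>C T x) \<and>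
     (\<exists>C. \<forall>x\<in>H. norm (T x) \<le> C * norm x)}"

definition ker :: "'a::chilbert_space set \<Rightarrow> ('a \<Rightarrow> 'b::chilbert_space) \<Rightarrow> 'a set" where
  "ker H T = {x \<in> H. T x = 0}"

definition orth_compl :: "'a::chilbert_space set \<Rightarrow> 'a set \<Rightarrow> 'a set" where
  "orth_compl H M = {x \<in> H. \<forall>y\<in>M. cinner x y = 0}"

section \<open>Dimensions as cardinals\<close>

text \<open>Theory Main hides these names.\<close>

abbreviation cfinite :: "'a rel \<Rightarrow> bool" where
  "cfinite \<equiv> BNF_Cardinal_Arithmetic.cfinite"

abbreviation cinfinite :: "'a rel \<Rightarrow> bool" where
  "cinfinite \<equiv> BNF_Cardinal_Arithmetic.cinfinite"

definition orthonormal_basis :: "'a::chilbert_space set \<Rightarrow> 'a set \<Rightarrow> bool" where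
  "orthonormal_basis B M \<longleftrightarrow>
     B \<subseteq> M \<and>
     (\<forall>x\<in>B. \<forall>y\<in>B. cinner x y = (if x = y then 1 else 0)) \<and>
     M \<subseteq> closure (cspan B)"

definition hilbert_dim :: "'a::chilbert_space set \<Rightarrow> 'a rel" where
  "hilbert_dim M = |SOME B. orthonormal_basis B M|"

text \<open>
  \<open>B\<close> is a set of representatives of an algebraic basis of the quotient \<open>H / M\<close>:
  linearly independent modulo \<open>M\<close> (so that distinct elements lie in distinct cosets)
  and spanning \<open>H\<close> modulo \<open>M\<close>.
\<close>

definition quotient_basis :: "'a::chilbert_space set \<Rightarrow> 'a set \<Rightarrow> 'a set \<Rightarrow> bool" where
  "quotient_basis B H M \<longleftrightarrow>
     B \<subseteq> H \<and>
     (\<forall>F c. finite F \<and> F \<subseteq> B \<and> (\<Sum>b\<in>F. c b *\<^sub>C b) \<in> M \<longrightarrow> (\<forall>b\<in>F. c b = 0)) \<and>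
     (\<forall>x\<in>H. \<exists>y\<in>cspan B. x - y \<in> M)"

definition quotient_dim :: "'a::chilbert_space set \<Rightarrow> 'a set \<Rightarrow> 'a rel" where
  "quotient_dim H M = |SOME B. quotient_basis B H M|"

definition alpha :: "'a::chilbert_space set \<Rightarrow> ('a \<Rightarrow> 'a) \<Rightarrow> 'a rel" where
  "alpha H T = hilbert_dim (ker H T)"

definition beta :: "'a::chilbert_space set \<Rightarrow> ('a \<Rightarrow> 'a) \<Rightarrow> 'a rel" where
  "beta H T = (if closed (T ` H) then hilbert_dim (orth_compl H (T ` H)) else quotient_dim H (T ` H))"

definition ereal_of_card :: "'a rel \<Rightarrow> ereal" where
  "ereal_of_card r = (if cfinite r then ereal (real (card (Field r))) else \<infinity>)"

text \<open>Only meaningful if \<open>alpha H T\<close> or \<open>beta H T\<close> is finite.\<close>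

definition ind :: "'a::chilbert_space set \<Rightarrow> ('a \<Rightarrow> 'a) \<Rightarrow> ereal" where
  "ind H T = ereal_of_card (alpha H T) - ereal_of_card (beta H T)"

definition Phi_minus :: "'a::chilbert_space set \<Rightarrow> ('a \<Rightarrow> 'a) set" where
  "Phi_minus H = {T \<in> bounded_ops H H. cfinite (beta H T)}"

definition Phi_minus_plus :: "'a::chilbert_space set \<Rightarrow> ('a \<Rightarrow> 'a) set" where
  "Phi_minus_plus H = {T \<in> Phi_minus H. ind H T \<ge> 0}"

section \<open>Upper triangular block operators\<close>

text \<open>
  The index set \<open>{1, \<dots>, n}\<close> is an arbitrary finite linearly ordered type, whose cardinality is
  \<open>n\<close>; the following are its elements \<open>1\<close> and \<open>n\<close> and the map \<open>s \<mapsto> s + 1\<close> for \<open>s < n\<close>.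
\<close>

definition first_idx :: "'n::{finite,linorder}" where
  "first_idx = Min UNIV"

definition last_idx :: "'n::{finite,linorder}" where
  "last_idx = Max UNIV"

definition next_idx :: "'n::{finite,linorder} \<Rightarrow> 'n" where
  "next_idx s = Min {t. s < t}"

definition hilbert_sum :: "('n::finite \<Rightarrow> 'a::chilbert_space set) \<Rightarrow> ('a, 'n) vec set" where
  "hilbert_sum H = {x. \<forall>s. x $ s \<in> H s}"

text \<open>The entries \<open>A i j\<close> with \<open>i \<ge> j\<close> are irrelevant.\<close>

definition block_tuples ::
  "('n::{finite,linorder} \<Rightarrow> 'a::chilbert_space set) \<Rightarrow> ('n \<Rightarrow> 'n \<Rightarrow> 'a \<Rightarrow> 'a) set" where
  "block_tuples H = {A. \<forall>i j. i < j \<longrightarrow> A i j \<in> bounded_ops (H j) (H i)}"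

definition upper_tri ::
  "('n::{finite,linorder} \<Rightarrow> 'a::chilbert_space \<Rightarrow> 'a) \<Rightarrow> ('n \<Rightarrow> 'n \<Rightarrow> 'a \<Rightarrow> 'a)
    \<Rightarrow> ('a, 'n) vec \<Rightarrow> ('a, 'n) vec" where
  "upper_tri D A x = (\<chi> i. D i (x $ i) + (\<Sum>j | i < j. A i j (x $ j)))"

definition card_sum :: "('n::finite \<Rightarrow> 'a rel) \<Rightarrow> ('n \<times> 'a) rel" where
  "card_sum r = BNF_Cardinal_Arithmetic.Csum |UNIV| r"

end

theory Submission
  imports Defs
begin

text \<open>
  All dimensions are counted algebraically. For subspaces \<open>M \<subseteq> V\<close> the codimension \<open>codim V M\<close> is an
  extended natural number, so that infinite values obey the same identities as finite ones. Call
  \<open>codim (ker T) {0}\<close> the nullity and the codimension of the range the defect of \<open>T\<close>. If \<open>T\<close> is a bounded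
  operator on a Hilbert space, these agree with \<open>\<alpha>(T)\<close> and \<open>\<beta>(T)\<close> as far as finite values and infinity
  are distinguished (\<open>card_enat_alpha\<close>, \<open>card_enat_beta\<close>): an orthonormal basis of a closed
  subspace is an algebraic basis if it is finite, and if it is infinite, then so is the algebraic
  dimension.

  Let \<open>T\<close> be the block operator, and let \<open>F k\<close> be the sum of the first \<open>k\<close> summands. \<open>T\<close> is upper
  triangular, so it leaves \<open>F k\<close> invariant, and on the quotient of \<open>F k\<close> by \<open>F (k - 1)\<close> it is \<open>D k\<close>. The
  exact sequence of kernels and cokernels of such a situation (lemma \<open>snake\<close>) contains a connecting
  map from the kernel of \<open>D k\<close>. If \<open>d\<close> is its nullity and \<open>c\<close> its rank, and \<open>x\<close> is the
  dimension of its cokernel, then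
    \<open>nullity (F k) = nullity (F (k - 1)) + d\<close>, \<open>\<alpha>(D k) = d + c\<close>,
    \<open>defect (F k) = x + \<beta>(D k)\<close> and \<open>defect (F (k - 1)) = x + c\<close>.
  The theorem follows from these four identities.

  If all \<open>\<beta>(D s)\<close> are finite, then induction on \<open>k\<close> yields \<open>nullity T + \<Sum>\<beta>(D s) = defect T + \<Sum>\<alpha>(D s)\<close>,
  where \<open>defect T\<close> is finite. Hence \<open>T\<close> belongs to \<open>\<Phi>\<^sub>-\<^sup>+\<close> if and only if \<open>\<Sum>\<beta>(D s) \<le> \<Sum>\<alpha>(D s)\<close>, whatever the
  entries above the diagonal are. This settles the second alternatives of (i) and (iii).

  Suppose that \<open>T\<close> has a finite defect but some \<open>\<beta>(D s)\<close> is infinite, and let \<open>s\<close> be the largest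
  such index. Since \<open>\<beta>(D k) \<le> defect (F k)\<close> holds for all \<open>k\<close>, \<open>s\<close> is smaller than \<open>n\<close>. If \<open>\<alpha>(D j)\<close> were
  finite for all \<open>j > s\<close>, then \<open>defect (F (k - 1)) \<le> defect (F k) + \<alpha>(D k)\<close> would carry finiteness down from
  \<open>defect T\<close> to \<open>defect (F s) \<ge> \<beta>(D s)\<close>. So \<open>\<alpha>(D j)\<close> is infinite for some \<open>j > s\<close>, and this is the first
  alternative of (iii).

  For the first alternative of (i), the hypothesis \<open>\<beta>(D s) \<le> \<alpha>(D (s + 1))\<close> yields an injection from an
  orthonormal basis of the complement of the range of \<open>D s\<close> into one of the kernel of \<open>D (s + 1)\<close>, hence a
  partial isometry from that kernel onto that complement. With these partial isometries next to the
  diagonal and zeros elsewhere, the range of \<open>T\<close> contains the first \<open>n - 1\<close> summands, and its defect is \<open>\<beta>(D n)\<close>.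
  An infinite set absorbs a countable one, so the injection into an infinite basis can be chosen
  to miss infinitely many of its elements. The partial isometry vanishes on those, which makes the nullity
  of \<open>T\<close> infinite.
\<close>

section \<open>Codimension of linear subspaces\<close>

text \<open>
  Operators are only constrained on their domain \<open>V\<close>, so linearity is relative to it as well.
\<close>

definition clinear_on :: "'a::chilbert_space set \<Rightarrow> ('a \<Rightarrow> 'b::chilbert_space) \<Rightarrow> bool" where
  "clinear_on V T \<longleftrightarrow> (\<forall>x\<in>V. \<forall>y\<in>V. T (x + y) = T x + T y) \<and> (\<forall>c. \<forall>x\<in>V. T (c *\<^sub>C x) = c *\<^sub>C T x)"

lemma clinear_on_subset: "clinear_on V T \<Longrightarrow> U \<subseteq> V \<Longrightarrow> clinear_on U T"
  unfolding clinear_on_def by blast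

lemma clinear_on_add: "clinear_on V T \<Longrightarrow> x \<in> V \<Longrightarrow> y \<in> V \<Longrightarrow> T (x + y) = T x + T y"
  unfolding clinear_on_def by blast

lemma clinear_on_scale: "clinear_on V T \<Longrightarrow> x \<in> V \<Longrightarrow> T (c *\<^sub>C x) = c *\<^sub>C T x"
  unfolding clinear_on_def by blast

lemma clinear_on_0:
  assumes "clinear_on V T" "csubspace V" shows "T 0 = 0"
  using clinear_on_scale[OF assms(1) complex_vector.subspace_0[OF assms(2)], of 0] by simp

lemma clinear_on_diff:
  assumes "clinear_on V T" "csubspace V" "x \<in> V" "y \<in> V" shows "T (x - y) = T x - T y"
proof -
  have "T (x - y + y) = T (x - y) + T y"
    using assms by (intro clinear_on_add) (auto intro: complex_vector.subspace_diff)
  then show ?thesis by simp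
qed

lemma clinear_on_sum:
  assumes "clinear_on V T" "csubspace V" "finite F" "F \<subseteq> V"
  shows "T (\<Sum>x\<in>F. c x *\<^sub>C x) = (\<Sum>x\<in>F. c x *\<^sub>C T x)"
  using assms(3,4)
proof (induction F rule: finite_induct)
  case empty
  then show ?case using clinear_on_0 assms by auto
next
  case (insert x F)
  have "(\<Sum>x\<in>F. c x *\<^sub>C x) \<in> V"
    using insert assms(2) by (intro complex_vector.subspace_sum) (auto intro: complex_vector.subspace_scale)
  then show ?case
    using insert clinear_on_add[OF assms(1)] clinear_on_scale[OF assms(1)] complex_vector.subspace_scale[OF assms(2)]
    by simp
qed

lemma csubspace_image:
  assumes "clinear_on V T" "csubspace V" shows "csubspace (T ` V)"
proof (rule complex_vector.subspaceI)
  show "0 \<in> T ` V"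
    using clinear_on_0[OF assms] complex_vector.subspace_0[OF assms(2)] by force
  show "x + y \<in> T ` V" if xy: "x \<in> T ` V" "y \<in> T ` V" for x y
  proof -
    from xy obtain a b where "a \<in> V" "x = T a" "b \<in> V" "y = T b" by blast
    then show ?thesis using clinear_on_add[OF assms(1), of a b] complex_vector.subspace_add[OF assms(2), of a b]
      by (metis imageI)
  qed
  show "c *\<^sub>C x \<in> T ` V" if x: "x \<in> T ` V" for c x
  proof -
    from x obtain a where "a \<in> V" "x = T a" by blast
    then show ?thesis using clinear_on_scale[OF assms(1), of a c] complex_vector.subspace_scale[OF assms(2), of a c]
      by (metis imageI)
  qed
qed

lemma csubspace_vimage:
  assumes "clinear_on V T" "csubspace V" "csubspace W" shows "csubspace {x \<in> V. T x \<in> W}"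
  using assms clinear_on_0[OF assms(1,2)]
  by (intro complex_vector.subspaceI)
     (auto simp: clinear_on_add[OF assms(1)] clinear_on_scale[OF assms(1)]
       intro: complex_vector.subspace_0 complex_vector.subspace_add complex_vector.subspace_scale)

lemma csubspace_ker:
  assumes "clinear_on V T" "csubspace V" shows "csubspace (ker V T)"
  using csubspace_vimage[OF assms complex_vector.subspace_single_0] unfolding ker_def by simp

definition indep_mod :: "'a::chilbert_space set \<Rightarrow> 'a set \<Rightarrow> bool" where
  "indep_mod B M \<longleftrightarrow> (\<forall>F c. finite F \<and> F \<subseteq> B \<and> (\<Sum>b\<in>F. c b *\<^sub>C b) \<in> M \<longrightarrow> (\<forall>b\<in>F. c b = 0))"

lemma indep_modD:
  "indep_mod B M \<Longrightarrow> finite F \<Longrightarrow> F \<subseteq> B \<Longrightarrow> (\<Sum>b\<in>F. c b *\<^sub>C b) \<in> M \<Longrightarrow> b \<in> F \<Longrightarrow> c b = 0"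
  unfolding indep_mod_def by blast

lemma quotient_basis_iff:
  "quotient_basis B V M \<longleftrightarrow> B \<subseteq> V \<and> indep_mod B M \<and> (\<forall>x\<in>V. \<exists>y\<in>cspan B. x - y \<in> M)"
  unfolding quotient_basis_def indep_mod_def by blast

lemma indep_mod_disjoint:
  assumes "indep_mod B M" shows "B \<inter> M = {}"
proof -
  have "b \<notin> M" if "b \<in> B" for b
    using indep_modD[OF assms, of "{b}" "\<lambda>_. 1" b] that by (auto simp: scaleC_one)
  then show ?thesis by blast
qed

text \<open>
  Steinitz exchange, transported from the quotient by \<open>M\<close> to the span of \<open>B\<close>: replacing each element of
  \<open>B'\<close> by a representative of its coset in \<open>cspan B\<close> preserves linear independence.
\<close>

lemma indep_mod_bound:
  assumes "csubspace M" and B': "indep_mod B' M" and "finite B"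
    and span: "\<And>x. x \<in> B' \<Longrightarrow> \<exists>y\<in>cspan B. x - y \<in> M"
  shows "finite B' \<and> card B' \<le> card B"
proof -
  obtain f where f: "\<And>x. x \<in> B' \<Longrightarrow> f x \<in> cspan B \<and> x - f x \<in> M"
    using span by metis
  have inj: "inj_on f B'"
  proof (rule inj_onI, rule ccontr)
    fix x y assume xy: "x \<in> B'" "y \<in> B'" "f x = f y" "x \<noteq> y"
    have "(x - f x) - (y - f y) \<in> M"
      using f xy assms(1) complex_vector.subspace_diff by blast
    then have "(\<Sum>b\<in>{x,y}. (if b = x then 1 else -1) *\<^sub>C b) \<in> M"
      using xy by (simp add: scaleC_one)
    from indep_modD[OF B' _ _ this, of x] xy show False by simp
  qed
  have "complex_vector.independent (f ` B')"
    unfolding complex_vector.independent_explicit_finite_subsets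
  proof (intro allI impI ballI)
    fix A u v assume A: "A \<subseteq> f ` B'" "finite A" "(\<Sum>v\<in>A. u v *\<^sub>C v) = 0" "v \<in> A"
    define F where "F = {x \<in> B'. f x \<in> A}"
    have bij: "bij_betw f F A"
      using inj A(1) unfolding bij_betw_def F_def inj_on_def by blast
    then have fin: "finite F" using A(2) bij_betw_finite by blast
    have "(\<Sum>x\<in>F. u (f x) *\<^sub>C x) = (\<Sum>x\<in>F. u (f x) *\<^sub>C (x - f x)) + (\<Sum>x\<in>F. u (f x) *\<^sub>C f x)"
      unfolding sum.distrib[symmetric] by (simp add: scaleC_add_right[symmetric])
    also have "(\<Sum>x\<in>F. u (f x) *\<^sub>C f x) = (\<Sum>v\<in>A. u v *\<^sub>C v)"
      using bij by (rule sum.reindex_bij_betw)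
    also have "(\<Sum>x\<in>F. u (f x) *\<^sub>C (x - f x)) + (\<Sum>v\<in>A. u v *\<^sub>C v) \<in> M"
      using f assms(1) unfolding A(3) F_def
      by (auto intro!: complex_vector.subspace_sum complex_vector.subspace_scale)
    finally have "(\<Sum>x\<in>F. u (f x) *\<^sub>C x) \<in> M" .
    with indep_modD[OF B' fin, of "\<lambda>x. u (f x)"] have "\<forall>x\<in>F. u (f x) = 0"
      unfolding F_def by blast
    then show "u v = 0" using bij A(4) unfolding bij_betw_def by blast
  qed
  from complex_vector.independent_span_bound[OF \<open>finite B\<close> this]
  have "finite (f ` B') \<and> card (f ` B') \<le> card B" using f by blast
  then show ?thesis using inj by (simp add: card_image finite_image_iff)
qed

text \<open>
  Extend a basis of \<open>M\<close> to a linearly independent set that spans \<open>V\<close>, and keep the new elements.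
\<close>

lemma quotient_basis_exists:
  assumes "csubspace M" "M \<subseteq> V" shows "\<exists>B. quotient_basis B V M"
proof -
  obtain C where C: "C \<subseteq> M" "complex_vector.independent C" "M \<subseteq> cspan C"
    using complex_vector.maximal_independent_subset by blast
  then have CV: "C \<subseteq> V" using assms by blast
  obtain E where E: "C \<subseteq> E" "E \<subseteq> V" "complex_vector.independent E" "V \<subseteq> cspan E"
    using complex_vector.maximal_independent_subset_extend[OF CV C(2)] by blast
  have spC: "cspan C = M"
    using C assms(1) by (metis complex_vector.span_minimal subset_antisym)
  have "quotient_basis (E - C) V M"
    unfolding quotient_basis_iff indep_mod_def
  proof (intro conjI allI impI ballI)
    show "E - C \<subseteq> V" using E by blast
    fix F c b assume F: "finite F \<and> F \<subseteq> E - C \<and> (\<Sum>b\<in>F. c b *\<^sub>C b) \<in> M" "b \<in> F"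
    then have "(\<Sum>b\<in>F. c b *\<^sub>C b) \<in> cspan C" using spC by simp
    then obtain t r where t: "finite t" "t \<subseteq> C" "(\<Sum>b\<in>F. c b *\<^sub>C b) = (\<Sum>a\<in>t. r a *\<^sub>C a)"
      unfolding complex_vector.span_explicit by blast
    define u where "u x = (if x \<in> F then c x else - r x)" for x
    have dis: "F \<inter> t = {}" using F t by blast
    have "(\<Sum>x\<in>F \<union> t. u x *\<^sub>C x) = (\<Sum>x\<in>F. u x *\<^sub>C x) + (\<Sum>x\<in>t. u x *\<^sub>C x)"
      using F t dis by (intro sum.union_disjoint) auto
    also have "(\<Sum>x\<in>F. u x *\<^sub>C x) = (\<Sum>b\<in>F. c b *\<^sub>C b)" by (simp add: u_def)
    also have "(\<Sum>x\<in>t. u x *\<^sub>C x) = (\<Sum>x\<in>t. - (r x *\<^sub>C x))"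
      using dis by (intro sum.cong) (auto simp: u_def)
    finally have "(\<Sum>x\<in>F \<union> t. u x *\<^sub>C x) = 0" using t by (simp add: sum_negf)
    then have "u b = 0"
      using E(1,3) F t unfolding complex_vector.independent_explicit_finite_subsets
      by (metis (no_types, lifting) Diff_subset UnI1 Un_least finite_Un subset_trans)
    then show "c b = 0" using F by (simp add: u_def)
  next
    fix x assume "x \<in> V"
    then have "x \<in> cspan ((E - C) \<union> C)" using E by (metis Diff_partition Un_commute subsetD)
    then obtain a b where "a \<in> cspan (E - C)" "b \<in> cspan C" "x = a + b"
      unfolding complex_vector.span_Un by blast
    then show "\<exists>y\<in>cspan (E - C). x - y \<in> M" using spC by auto
  qed
  then show ?thesis by blast
qed

text \<open>
  The value does not depend on the chosen basis, see \<open>codim_eq\<close>. It identifies all infinite dimensions;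
  only the comparison \<open>\<beta>(D s) \<le> \<alpha>(D (s + 1))\<close> distinguishes them, and it is used directly.
\<close>

definition codim :: "'a::chilbert_space set \<Rightarrow> 'a set \<Rightarrow> enat" where
  "codim V M = (let B = (SOME B. quotient_basis B V M) in if finite B then enat (card B) else \<infinity>)"

lemma codim_eq:
  assumes "csubspace M" "quotient_basis B V M"
  shows "codim V M = (if finite B then enat (card B) else \<infinity>)"
proof -
  define B' where "B' = (SOME B. quotient_basis B V M)"
  have B': "quotient_basis B' V M" unfolding B'_def using assms(2) by (rule someI)
  have 1: "finite B' \<and> card B' \<le> card B" if "finite B"
    using indep_mod_bound[OF assms(1), of B' B] that B' assms(2) unfolding quotient_basis_iff by blast
  have 2: "finite B \<and> card B \<le> card B'" if "finite B'"
    using indep_mod_bound[OF assms(1), of B B'] that B' assms(2) unfolding quotient_basis_iff by blast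
  show ?thesis unfolding codim_def B'_def[symmetric] Let_def using 1 2 by auto
qed

lemma codim_infinite:
  assumes "csubspace M" "M \<subseteq> V" "B \<subseteq> V" "indep_mod B M" "infinite B"
  shows "codim V M = \<infinity>"
proof -
  obtain C where C: "quotient_basis C V M" using quotient_basis_exists assms by blast
  then have "infinite C"
    using indep_mod_bound[OF assms(1,4), of C] assms(3,5) unfolding quotient_basis_iff by blast
  then show ?thesis using codim_eq[OF assms(1) C] by simp
qed

lemma codim_self:
  assumes "csubspace M" shows "codim M M = 0"
proof -
  have "quotient_basis {} M M" by (auto simp: quotient_basis_iff indep_mod_def)
  from codim_eq[OF assms this] show ?thesis by (simp add: zero_enat_def)
qed

text \<open>
  Bases of the two successive quotients are disjoint, and their union is a basis of the total quotient.
\<close>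

lemma codim_tower:
  assumes "csubspace N" "csubspace M" "N \<subseteq> M" "M \<subseteq> V"
  shows "codim V N = codim V M + codim M N"
proof -
  obtain B where B: "quotient_basis B V M" using quotient_basis_exists assms by blast
  obtain C where C: "quotient_basis C M N" using quotient_basis_exists assms by blast
  have CM: "C \<subseteq> M" using C unfolding quotient_basis_iff by blast
  have dis: "B \<inter> C = {}" using B CM indep_mod_disjoint unfolding quotient_basis_iff by blast
  have "quotient_basis (B \<union> C) V N"
    unfolding quotient_basis_iff indep_mod_def
  proof (intro conjI allI impI)
    show "B \<union> C \<subseteq> V" using B CM assms unfolding quotient_basis_iff by blast
    fix F c assume F: "finite F \<and> F \<subseteq> B \<union> C \<and> (\<Sum>b\<in>F. c b *\<^sub>C b) \<in> N"
    have split: "(\<Sum>b\<in>F. c b *\<^sub>C b) = (\<Sum>b\<in>F\<inter>B. c b *\<^sub>C b) + (\<Sum>b\<in>F-B. c b *\<^sub>C b)"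
      using F sum.Int_Diff by blast
    have "(\<Sum>b\<in>F-B. c b *\<^sub>C b) \<in> M"
      using F CM assms(2) by (auto intro!: complex_vector.subspace_sum complex_vector.subspace_scale)
    then have "(\<Sum>b\<in>F. c b *\<^sub>C b) - (\<Sum>b\<in>F-B. c b *\<^sub>C b) \<in> M"
      using F assms by (intro complex_vector.subspace_diff) auto
    then have "(\<Sum>b\<in>F\<inter>B. c b *\<^sub>C b) \<in> M" by (simp add: split)
    then have 1: "c b = 0" if "b \<in> F \<inter> B" for b
      using B F that indep_modD[of B M "F \<inter> B" c b] unfolding quotient_basis_iff by blast
    then have "(\<Sum>b\<in>F-B. c b *\<^sub>C b) \<in> N" using split F by (simp add: sum.neutral)
    then have 2: "c b = 0" if "b \<in> F - B" for b
      using C F that indep_modD[of C N "F - B" c b] unfolding quotient_basis_iff by blast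
    show "\<forall>b\<in>F. c b = 0" using 1 2 by blast
  next
    show "\<forall>x\<in>V. \<exists>y\<in>cspan (B \<union> C). x - y \<in> N"
    proof
      fix x assume "x \<in> V"
      then obtain y where y: "y \<in> cspan B" "x - y \<in> M" using B unfolding quotient_basis_iff by blast
      then obtain z where z: "z \<in> cspan C" "x - y - z \<in> N" using C unfolding quotient_basis_iff by blast
      show "\<exists>y\<in>cspan (B \<union> C). x - y \<in> N"
        using y z complex_vector.span_Un[of B C] by (intro bexI[of _ "y + z"]) (auto simp: algebra_simps)
    qed
  qed
  from codim_eq[OF assms(1) this] codim_eq[OF assms(2) B] codim_eq[OF assms(1) C] dis
  show ?thesis by (simp add: card_Un_disjoint)
qed

text \<open>
  First isomorphism theorem: any choice of preimages of a basis of the image quotient is a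
  basis of the original quotient.
\<close>

lemma codim_image:
  assumes p: "clinear_on V p" and V: "csubspace V" and M: "csubspace M" "M \<subseteq> V" and K: "ker V p \<subseteq> M"
  shows "codim V M = codim (p ` V) (p ` M)"
proof -
  have pM: "csubspace (p ` M)" using csubspace_image clinear_on_subset p M by blast
  obtain B where B: "quotient_basis B (p ` V) (p ` M)" using quotient_basis_exists[OF pM] M by blast
  then have "\<forall>b\<in>B. \<exists>x\<in>V. p x = b" unfolding quotient_basis_iff by blast
  then obtain g where g: "\<And>b. b \<in> B \<Longrightarrow> g b \<in> V \<and> p (g b) = b" by metis
  have inj: "inj_on g B" using g by (metis inj_onI)
  have "quotient_basis (g ` B) V M"
    unfolding quotient_basis_iff indep_mod_def
  proof (intro conjI allI impI ballI)
    show sub: "g ` B \<subseteq> V" using g by blast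
    fix F c b assume F: "finite F \<and> F \<subseteq> g ` B \<and> (\<Sum>b\<in>F. c b *\<^sub>C b) \<in> M" "b \<in> F"
    have FV: "F \<subseteq> V" using F sub by blast
    have "p (\<Sum>b\<in>F. c b *\<^sub>C b) \<in> p ` M" using F by blast
    then have "(\<Sum>b\<in>F. c b *\<^sub>C p b) \<in> p ` M"
      using clinear_on_sum[OF p V _ FV, of c] F by simp
    also have "(\<Sum>b\<in>F. c b *\<^sub>C p b) = (\<Sum>b\<in>p ` F. c (g b) *\<^sub>C b)"
    proof -
      have gp: "g (p x) = x" if "x \<in> F" for x using that F g by auto
      then have "inj_on p F" by (metis inj_onI)
      then show ?thesis by (simp add: sum.reindex gp)
    qed
    finally have "(\<Sum>b\<in>p ` F. c (g b) *\<^sub>C b) \<in> p ` M" .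
    moreover have "p ` F \<subseteq> B" using F g by auto
    ultimately have "c (g (p b)) = 0"
      using B F indep_modD[of B "p ` M" "p ` F" "\<lambda>b. c (g b)" "p b"] unfolding quotient_basis_iff by blast
    then show "c b = 0" using F g by auto
  next
    fix x assume x: "x \<in> V"
    have gV: "cspan (g ` B) \<subseteq> V" using g V by (intro complex_vector.span_minimal) auto
    have "csubspace (p ` cspan (g ` B))"
      using p gV clinear_on_subset by (intro csubspace_image complex_vector.subspace_span) blast
    moreover have "B \<subseteq> p ` cspan (g ` B)"
      using g by (metis complex_vector.span_base imageI subsetI)
    ultimately have sp: "cspan B \<subseteq> p ` cspan (g ` B)" by (rule complex_vector.span_minimal[rotated])
    obtain y where "y \<in> cspan B" "p x - y \<in> p ` M" using B x unfolding quotient_basis_iff by blast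
    then obtain z m where z: "z \<in> cspan (g ` B)" "m \<in> M" "p x - p z = p m" using sp by blast
    have zV: "z \<in> V" "m \<in> V" "x - z \<in> V" using z gV M V x complex_vector.subspace_diff by blast+
    then have "p (x - z - m) = 0" using z x clinear_on_diff[OF p V] by simp
    then have "x - z - m \<in> M" using K zV V complex_vector.subspace_diff unfolding ker_def by blast
    then have "x - z \<in> M" using z M(1) complex_vector.subspace_add by (metis diff_add_cancel)
    then show "\<exists>y\<in>cspan (g ` B). x - y \<in> M" using z by blast
  qed
  from codim_eq[OF M(1) this] codim_eq[OF pM B] inj show ?thesis
    by (simp add: card_image finite_image_iff)
qed

text \<open>
  Second isomorphism theorem.
\<close>

lemma codim_sum:
  assumes M: "csubspace M" and K: "csubspace K"
  shows "codim {x + y |x y. x \<in> M \<and> y \<in> K} M = codim K (K \<inter> M)"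
proof -
  have KM: "csubspace (K \<inter> M)" using M K by (rule complex_vector.subspace_inter[rotated])
  obtain B where B: "quotient_basis B K (K \<inter> M)" using quotient_basis_exists[OF KM] by blast
  have BK: "B \<subseteq> K" using B unfolding quotient_basis_iff by blast
  have "quotient_basis B {x + y |x y. x \<in> M \<and> y \<in> K} M"
    unfolding quotient_basis_iff indep_mod_def
  proof (intro conjI allI impI)
    show "B \<subseteq> {x + y |x y. x \<in> M \<and> y \<in> K}"
      using BK complex_vector.subspace_0[OF M] by force
    fix F c assume F: "finite F \<and> F \<subseteq> B \<and> (\<Sum>b\<in>F. c b *\<^sub>C b) \<in> M"
    then have "(\<Sum>b\<in>F. c b *\<^sub>C b) \<in> K"
      using BK K by (auto intro!: complex_vector.subspace_sum complex_vector.subspace_scale)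
    then show "\<forall>b\<in>F. c b = 0"
      using F B indep_modD[of B "K \<inter> M" F c] unfolding quotient_basis_iff by blast
  next
    show "\<forall>x\<in>{x + y |x y. x \<in> M \<and> y \<in> K}. \<exists>y\<in>cspan B. x - y \<in> M"
    proof
      fix z assume "z \<in> {x + y |x y. x \<in> M \<and> y \<in> K}"
      then obtain x y where z: "z = x + y" "x \<in> M" "y \<in> K" by blast
      then obtain w where w: "w \<in> cspan B" "y - w \<in> K \<inter> M" using B unfolding quotient_basis_iff by blast
      have "z - w = x + (y - w)" using z by simp
      then show "\<exists>y\<in>cspan B. z - y \<in> M" using w z complex_vector.subspace_add[OF M, of x "y - w"] by (intro bexI[of _ w]) (simp_all add: add_diff_eq)
    qed
  qed
  from codim_eq[OF M this] codim_eq[OF KM B] show ?thesis by simp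
qed

text \<open>
  Pass from \<open>M\<close> to \<open>V\<close> through the sum of \<open>M\<close> and the kernel of \<open>p\<close>. The lower step is a quotient of the
  kernel, the upper one a quotient of the image.
\<close>

lemma codim_ker_image:
  assumes p: "clinear_on V p" and V: "csubspace V" and M: "csubspace M" "M \<subseteq> V"
  shows "codim V M = codim (ker V p) (ker V p \<inter> M) + codim (p ` V) (p ` M)"
proof -
  let ?S = "{x + y |x y. x \<in> M \<and> y \<in> ker V p}"
  have K: "csubspace (ker V p)" "ker V p \<subseteq> V" using csubspace_ker[OF p V] by (auto simp: ker_def)
  have S: "csubspace ?S" using complex_vector.subspace_sums[OF M(1) K(1)] .
  have MS: "M \<subseteq> ?S" using complex_vector.subspace_0[OF K(1)] by force
  have KS: "ker V p \<subseteq> ?S" using complex_vector.subspace_0[OF M(1)] by force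
  have SV: "?S \<subseteq> V" using M K V complex_vector.subspace_add by blast
  have "p ` ?S = p ` M"
  proof
    show "p ` ?S \<subseteq> p ` M"
    proof (clarify)
      fix x y assume "x \<in> M" "y \<in> ker V p"
      then have "p (x + y) = p x" using clinear_on_add[OF p, of x y] M unfolding ker_def by auto
      then show "p (x + y) \<in> p ` M" using \<open>x \<in> M\<close> by simp
    qed
  qed (use MS in blast)
  then have "codim V ?S = codim (p ` V) (p ` M)" using codim_image[OF p V S SV KS] by simp
  then show ?thesis
    using codim_tower[OF M(1) S MS SV] codim_sum[OF M(1) K(1)] by (simp add: add.commute)
qed

text \<open>
  The sequence \<open>0 \<rightarrow> U \<rightarrow> V \<rightarrow> p V \<rightarrow> 0\<close>, on which \<open>T\<close>, \<open>T\<close> and \<open>D\<close> act, has a six-term exact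
  kernel-cokernel sequence. Here \<open>d\<close> is the dimension of the image of \<open>ker T\<close> in \<open>ker D\<close>, \<open>c\<close> is the rank
  of the connecting map, and \<open>x\<close> is the dimension of its cokernel. The identities
  hold in the extended naturals, so they also propagate infinite values.
\<close>

lemma snake:
  fixes T :: "'a::chilbert_space \<Rightarrow> 'a" and p :: "'a \<Rightarrow> 'b::chilbert_space"
  assumes V: "csubspace V" and T: "clinear_on V T" and p: "clinear_on V p"
    and TV: "T ` V \<subseteq> V" and U: "U = ker V p" and TU: "T ` U \<subseteq> U"
    and D: "clinear_on (p ` V) D" and pT: "\<And>x. x \<in> V \<Longrightarrow> p (T x) = D (p x)"
  shows "\<exists>d c x. codim (ker V T) {0} = codim (ker U T) {0} + d
    \<and> codim (ker (p ` V) D) {0} = d + c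
    \<and> codim V (T ` V) = x + codim (p ` V) (D ` p ` V)
    \<and> codim U (T ` U) = x + c"
proof -
  have Us: "csubspace U" "U \<subseteq> V" using csubspace_ker[OF p V] U by (auto simp: ker_def)
  have Q: "csubspace (p ` V)" using csubspace_image[OF p V] .
  have kT: "csubspace (ker V T)" "ker V T \<subseteq> V" using csubspace_ker[OF T V] by (auto simp: ker_def)
  have kD: "csubspace (ker (p ` V) D)" using csubspace_ker[OF D Q] .
  have TVs: "csubspace (T ` V)" using csubspace_image[OF T V] .
  have TUs: "csubspace (T ` U)" using csubspace_image clinear_on_subset T Us by blast
  note z = complex_vector.subspace_single_0
  have p0: "p 0 = 0" using clinear_on_0[OF p V] .
  have T0: "T 0 = 0" using clinear_on_0[OF T V] .
  define pk where "pk = p ` ker V T"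
  have pks: "csubspace pk" unfolding pk_def using csubspace_image clinear_on_subset p kT by blast
  have pkD: "pk \<subseteq> ker (p ` V) D"
  proof
    fix y assume "y \<in> pk"
    then obtain x where x: "x \<in> V" "T x = 0" "y = p x" unfolding pk_def ker_def by blast
    then show "y \<in> ker (p ` V) D" using pT[of x] p0 by (auto simp: ker_def)
  qed
  \<comment> \<open>The two descriptions of \<open>c\<close> agree because both are the codimension
    of \<open>U + ker T\<close> in the preimage \<open>G\<close> of \<open>U\<close> under
    \<open>T\<close>, computed from its image under \<open>T\<close> and from its image under
    \<open>p\<close>.\<close>
  define G where "G = {x \<in> V. p x \<in> ker (p ` V) D}"
  have Gs: "csubspace G" unfolding G_def using csubspace_vimage[OF p V kD] .
  have GV: "G \<subseteq> V" unfolding G_def by blast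
  have UG: "U \<subseteq> G" using U complex_vector.subspace_0[OF kD] unfolding G_def ker_def by auto
  have kG: "ker V T \<subseteq> G" using pkD unfolding G_def pk_def ker_def by blast
  define S where "S = {x + y |x y. x \<in> U \<and> y \<in> ker V T}"
  have Ss: "csubspace S" unfolding S_def using complex_vector.subspace_sums[OF Us(1) kT(1)] .
  have SG: "S \<subseteq> G" unfolding S_def using UG kG Gs complex_vector.subspace_add by blast
  have US: "U \<subseteq> S" unfolding S_def using complex_vector.subspace_0[OF kT(1)] by force
  have kS: "ker V T \<subseteq> S" unfolding S_def using complex_vector.subspace_0[OF Us(1)] by force
  have "T ` S = T ` U"
  proof
    show "T ` S \<subseteq> T ` U"
    proof
      fix w assume "w \<in> T ` S"
      then obtain x y where "x \<in> U" "y \<in> ker V T" "w = T (x + y)" unfolding S_def by blast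
      then show "w \<in> T ` U" using clinear_on_add[OF T, of x y] Us unfolding ker_def by auto
    qed
  qed (use US in blast)
  moreover have "p ` S = pk"
  proof
    show "p ` S \<subseteq> pk"
    proof
      fix w assume "w \<in> p ` S"
      then obtain x y where "x \<in> U" "y \<in> ker V T" "w = p (x + y)" unfolding S_def by blast
      then show "w \<in> pk" using clinear_on_add[OF p, of x y] unfolding U ker_def pk_def by auto
    qed
  qed (use kS in \<open>auto simp: pk_def\<close>)
  moreover have "p ` G = ker (p ` V) D" unfolding G_def ker_def by auto
  moreover have "T ` G = T ` V \<inter> U"
    using pT TV unfolding G_def U ker_def by force
  moreover have "ker G T = ker V T" using kG GV unfolding ker_def by blast
  moreover have "ker G p = U" using UG GV unfolding U ker_def by blast
  ultimately have "codim G S = codim (ker V T) (ker V T \<inter> S) + codim (T ` V \<inter> U) (T ` U)"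
      "codim G S = codim U (U \<inter> S) + codim (ker (p ` V) D) pk"
    using codim_ker_image[OF clinear_on_subset[OF T GV] Gs Ss SG]
      codim_ker_image[OF clinear_on_subset[OF p GV] Gs Ss SG] by simp_all
  then have c: "codim (T ` V \<inter> U) (T ` U) = codim (ker (p ` V) D) pk"
    using US kS codim_self[OF kT(1)] codim_self[OF Us(1)] by (simp add: Int_absorb2)
  have 1: "codim (ker V T) {0} = codim (ker U T) {0} + codim pk {0}"
  proof -
    have "ker (ker V T) p = ker U T" unfolding U ker_def by blast
    moreover have "ker U T \<inter> {0} = {0}" using complex_vector.subspace_0[OF Us(1)] T0 by (auto simp: ker_def)
    ultimately show ?thesis
      using codim_ker_image[OF clinear_on_subset[OF p kT(2)] kT(1) z] complex_vector.subspace_0[OF kT(1)] p0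
      by (simp add: pk_def)
  qed
  have 2: "codim (ker (p ` V) D) {0} = codim pk {0} + codim (T ` V \<inter> U) (T ` U)"
    unfolding c using codim_tower[OF z pks _ pkD] complex_vector.subspace_0[OF pks] by (simp add: add.commute)
  have "p ` T ` V = D ` p ` V" using pT by (force simp: image_image)
  then have 3: "codim V (T ` V) = codim U (T ` V \<inter> U) + codim (p ` V) (D ` p ` V)"
    using codim_ker_image[OF p V TVs TV] unfolding U[symmetric] by (simp add: Int_commute)
  have 4: "codim U (T ` U) = codim U (T ` V \<inter> U) + codim (T ` V \<inter> U) (T ` U)"
    using Us TU by (intro codim_tower TUs complex_vector.subspace_inter TVs) auto
  show ?thesis using 1 2 3 4 by blast
qed

section \<open>Complex inner products and orthogonal projection\<close>

lemma cinner_scaleC_right: "cinner x (c *\<^sub>C y) = cnj c * cinner x y"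
  using cinner_commute[of x "c *\<^sub>C y"] cinner_commute[of x y] by (simp add: cinner_scaleC_left)

lemma cinner_zero_left [simp]: "cinner 0 x = 0"
  using cinner_add_left[of 0 0 x] by simp

lemma cinner_diff_left: "cinner (x - y) z = cinner x z - cinner y z"
  using cinner_add_left[of "x - y" y z] by simp

lemma cinner_sum_left: "cinner (\<Sum>x\<in>F. f x) y = (\<Sum>x\<in>F. cinner (f x) y)"
  by (induction F rule: infinite_finite_induct) (auto simp: cinner_add_left)

lemma cinner_self: "cinner x x = complex_of_real ((norm x)\<^sup>2)"
proof -
  have "Im (cinner x x) = 0" using cinner_commute[of x x] by (metis cnj.simps(2) equal_neg_zero)
  then show ?thesis
    by (simp add: complex_eq_iff power2_norm_eq_inner inner_eq_Re_cinner)
qed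

text \<open>
  The complex inner product is a combination of two real ones, which transfers continuity from the real theory.
\<close>

lemma cinner_eq_inner: "cinner x y = Complex (inner x y) (inner x (\<i> *\<^sub>C y))"
  by (simp add: inner_eq_Re_cinner cinner_scaleC_right complex_eq_iff)

lemma norm_scaleC: "norm (c *\<^sub>C x) = cmod c * norm (x::'a::complex_inner)"
proof -
  have "complex_of_real ((norm (c *\<^sub>C x))\<^sup>2) = c * cnj c * complex_of_real ((norm x)\<^sup>2)"
    unfolding cinner_self[symmetric] by (simp add: cinner_scaleC_left cinner_scaleC_right)
  also have "\<dots> = complex_of_real ((cmod c * norm x)\<^sup>2)"
    by (simp add: complex_norm_square[symmetric] power_mult_distrib)
  finally have "(norm (c *\<^sub>C x))\<^sup>2 = (cmod c * norm x)\<^sup>2"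
    using of_real_eq_iff by blast
  then show ?thesis by (simp add: power2_eq_iff_nonneg)
qed

lemma bounded_linear_scaleC: "bounded_linear (\<lambda>x::'a::complex_inner. c *\<^sub>C x)"
proof (rule bounded_linear_intro)
  show "c *\<^sub>C (r *\<^sub>R x) = r *\<^sub>R (c *\<^sub>C x)" for r and x :: 'a
    by (simp add: scaleR_scaleC mult.commute)
  show "norm (c *\<^sub>C x) \<le> norm x * cmod c" for x :: 'a
    by (simp add: norm_scaleC mult.commute)
qed (simp add: scaleC_add_right)

lemma bounded_linear_scaleC_left: "bounded_linear (\<lambda>c. c *\<^sub>C (x::'a::complex_inner))"
proof (rule bounded_linear_intro)
  show "(r *\<^sub>R c) *\<^sub>C x = r *\<^sub>R (c *\<^sub>C x)" for r and c
    by (simp add: scaleR_scaleC scaleR_conv_of_real)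
  show "norm (c *\<^sub>C x) \<le> norm c * norm x" for c
    by (simp add: norm_scaleC)
qed (simp add: scaleC_add_left)

lemma continuous_on_cinner_left: "continuous_on S (\<lambda>x::'a::complex_inner. cinner x y)"
  unfolding cinner_eq_inner by (intro continuous_intros)

lemma csubspace_imp_subspace: "csubspace M \<Longrightarrow> subspace M"
  by (rule subspaceI) (auto simp: scaleR_scaleC complex_vector.subspace_0 complex_vector.subspace_add
     complex_vector.subspace_scale)

text \<open>
  A minimizing sequence for the distance from \<open>x\<close> to \<open>M\<close> is Cauchy by the parallelogram law, and its
  limit is the foot of the perpendicular, since otherwise moving along \<open>y\<close> would decrease the distance.
\<close>

lemma real_projection:
  fixes M :: "'a::{real_inner,complete_space} set"
  assumes "subspace M" "closed M"
  shows "\<exists>m\<in>M. \<forall>y\<in>M. inner (x - m) y = 0"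
proof -
  define d where "d = (INF m\<in>M. (norm (x - m))\<^sup>2)"
  have M0: "0 \<in> M" using assms(1) subspace_0 by blast
  have bdd: "bdd_below ((\<lambda>m. (norm (x - m))\<^sup>2) ` M)" by (rule bdd_belowI[of _ 0]) auto
  have d_le: "d \<le> (norm (x - m))\<^sup>2" if "m \<in> M" for m
    unfolding d_def using bdd that by (intro cINF_lower) auto
  have "\<exists>m\<in>M. (norm (x - m))\<^sup>2 < d + 1 / Suc n" for n
    using cInf_lessD[of "(\<lambda>m. (norm (x - m))\<^sup>2) ` M" "d + 1 / Suc n"] M0 unfolding d_def by force
  then obtain m where m: "\<And>n. m n \<in> M" "\<And>n. (norm (x - m n))\<^sup>2 < d + 1 / Suc n" by metis
  have par: "(norm (a - b))\<^sup>2 \<le> 2 * (norm (x - a))\<^sup>2 + 2 * (norm (x - b))\<^sup>2 - 4 * d" if "a \<in> M" "b \<in> M" for a b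
  proof -
    have "(1/2) *\<^sub>R (a + b) \<in> M" using that assms(1) subspace_add subspace_scale by blast
    from d_le[OF this] have "4 * d \<le> (norm (2 *\<^sub>R (x - (1/2) *\<^sub>R (a + b))))\<^sup>2"
      by (simp add: power_mult_distrib)
    also have "2 *\<^sub>R (x - (1/2) *\<^sub>R (a + b)) = (x - a) + (x - b)" by (simp add: algebra_simps scaleR_2)
    also have "(norm ((x - a) + (x - b)))\<^sup>2 = 2 * (norm (x - a))\<^sup>2 + 2 * (norm (x - b))\<^sup>2 - (norm (a - b))\<^sup>2"
      by (simp add: power2_norm_eq_inner inner_simps inner_commute algebra_simps)
    finally show ?thesis by simp
  qed
  have "Cauchy m"
  proof (rule metric_CauchyI)
    fix e :: real assume "0 < e"
    then obtain N where N: "inverse (real (Suc N)) < e\<^sup>2 / 4"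
      using reals_Archimedean[of "e\<^sup>2/4"] by auto
    have bound: "1 / real (Suc k) < e\<^sup>2 / 4" if "k \<ge> N" for k
      using that N by (smt (verit) frac_le inverse_eq_divide of_nat_0_less_iff of_nat_le_iff Suc_le_mono zero_less_Suc)
    have "dist (m k) (m l) < e" if "k \<ge> N" "l \<ge> N" for k l
    proof -
      have "(norm (m k - m l))\<^sup>2 < e\<^sup>2"
        using par[OF m(1) m(1), of k l] m(2)[of k] m(2)[of l] bound[OF that(1)] bound[OF that(2)] by linarith
      then show ?thesis using \<open>0 < e\<close> by (simp add: dist_norm power_less_imp_less_base)
    qed
    then show "\<exists>N. \<forall>k\<ge>N. \<forall>l\<ge>N. dist (m k) (m l) < e" by blast
  qed
  then obtain l where l: "m \<longlonglongrightarrow> l" by (metis Cauchy_convergent_iff convergentD)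
  have lM: "l \<in> M" using assms(2) m(1) l closed_sequentially by blast
  have "(\<lambda>n. (norm (x - m n))\<^sup>2) \<longlonglongrightarrow> (norm (x - l))\<^sup>2" by (intro tendsto_intros l)
  moreover have "(\<lambda>n. d + 1 / Suc n) \<longlonglongrightarrow> d + 0"
    by (intro tendsto_intros) (use LIMSEQ_inverse_real_of_nat in \<open>simp add: inverse_eq_divide\<close>)
  ultimately have "(norm (x - l))\<^sup>2 \<le> d + 0"
    by (rule LIMSEQ_le) (meson m(2) less_imp_le)
  then have ld: "(norm (x - l))\<^sup>2 \<le> d" by simp
  have "inner (x - l) y = 0" if y: "y \<in> M" for y
  proof (cases "y = 0")
    case False
    \<comment> \<open>The minimum of the distance along the line through \<open>l\<close> in
      direction \<open>y\<close>.\<close>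
    define t where "t = inner (x - l) y / (norm y)\<^sup>2"
    have "l + t *\<^sub>R y \<in> M" using lM y assms(1) subspace_add subspace_scale by blast
    from d_le[OF this] ld have "(norm (x - l))\<^sup>2 \<le> (norm (x - (l + t *\<^sub>R y)))\<^sup>2"
      by (rule order_trans[rotated])
    also have "x - (l + t *\<^sub>R y) = (x - l) - t *\<^sub>R y" by simp

    also have "(norm ((x - l) - t *\<^sub>R y))\<^sup>2 = (norm (x - l))\<^sup>2 - 2 * t * inner (x - l) y + t\<^sup>2 * (norm y)\<^sup>2"
    proof -
      have "(norm (z - t *\<^sub>R y))\<^sup>2 = (norm z)\<^sup>2 - 2 * t * inner z y + t\<^sup>2 * (norm y)\<^sup>2" for z
        unfolding power2_norm_eq_inner inner_diff_left inner_diff_right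
        by (simp add: inner_commute[of y z] power2_eq_square)
      then show ?thesis .
    qed
    also have "\<dots> = (norm (x - l))\<^sup>2 - (inner (x - l) y)\<^sup>2 / (norm y)\<^sup>2"
      using False unfolding t_def by (simp add: field_simps power2_eq_square)
    finally show ?thesis using False by (simp add: divide_le_0_iff)
  qed simp
  then show ?thesis using lM by blast
qed

text \<open>
  A complex subspace is stable under multiplication with the imaginary unit, so being orthogonal to it in the real sense is
  the same as in the complex sense.
\<close>

lemma projection:
  fixes M :: "'a::chilbert_space set"
  assumes "hilbert M"
  shows "\<exists>m\<in>M. \<forall>y\<in>M. cinner (x - m) y = 0"
proof -
  have s: "csubspace M" "closed M" using assms by (auto simp: hilbert_def)
  obtain m where m: "m \<in> M" "\<forall>y\<in>M. inner (x - m) y = 0"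
    using real_projection[of M x] s csubspace_imp_subspace by blast
  have "cinner (x - m) y = 0" if "y \<in> M" for y
    using m that complex_vector.subspace_scale[OF s(1), of y \<i>] unfolding cinner_eq_inner
    by (simp add: complex_eq_iff)
  then show ?thesis using m by blast
qed

section \<open>Orthonormal sets and Hilbert dimension\<close>

definition orthonormal :: "'a::complex_inner set \<Rightarrow> bool" where
  "orthonormal B \<longleftrightarrow> (\<forall>x\<in>B. \<forall>y\<in>B. cinner x y = (if x = y then 1 else 0))"

lemma orthonormal_subset: "orthonormal B \<Longrightarrow> C \<subseteq> B \<Longrightarrow> orthonormal C"
  unfolding orthonormal_def by blast

lemma cinner_orthonormal_sum:
  assumes "orthonormal B" "finite F" "F \<subseteq> B" "b \<in> B"
  shows "cinner (\<Sum>x\<in>F. c x *\<^sub>C x) b = (if b \<in> F then c b else 0)"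
proof -
  have "cinner (\<Sum>x\<in>F. c x *\<^sub>C x) b = (\<Sum>x\<in>F. c x * (if x = b then 1 else 0))"
    unfolding cinner_sum_left cinner_scaleC_left using assms
    by (intro sum.cong) (auto simp: orthonormal_def)
  also have "\<dots> = (\<Sum>x\<in>F. if x = b then c x else 0)" by (intro sum.cong) auto
  also have "\<dots> = (if b \<in> F then c b else 0)" using assms(2) by (simp add: sum.delta)
  finally show ?thesis .
qed

lemma orthonormal_indep:
  assumes "orthonormal B" shows "indep_mod B {0}"
  unfolding indep_mod_def
proof (intro allI impI ballI)
  fix F c b assume F: "finite F \<and> F \<subseteq> B \<and> (\<Sum>b\<in>F. c b *\<^sub>C b) \<in> {0}" "b \<in> F"
  then show "c b = 0" using cinner_orthonormal_sum[OF assms, of F b c] by auto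
qed

lemma orthonormal_expansion:
  assumes "orthonormal B" "finite B"
  shows "x \<in> cspan B \<longleftrightarrow> x = (\<Sum>b\<in>B. cinner x b *\<^sub>C b)"
proof
  assume "x \<in> cspan B"
  then obtain u where u: "x = (\<Sum>b\<in>B. u b *\<^sub>C b)"
    unfolding complex_vector.span_finite[OF assms(2)] by blast
  have "cinner x b = u b" if "b \<in> B" for b
    using cinner_orthonormal_sum[OF assms(1,2), of b u] that u by simp
  then show "x = (\<Sum>b\<in>B. cinner x b *\<^sub>C b)" using u by simp
next
  assume x: "x = (\<Sum>b\<in>B. cinner x b *\<^sub>C b)"
  show "x \<in> cspan B"
    by (subst x) (rule complex_vector.span_sum, rule complex_vector.span_scale, rule complex_vector.span_base)
qed

text \<open>
  The span is the set where \<open>x\<close> equals its finite Fourier expansion, a continuous condition.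
\<close>

lemma closed_cspan_orthonormal:
  fixes B :: "'a::chilbert_space set"
  assumes "orthonormal B" "finite B" shows "closed (cspan B)"
proof -
  have "cspan B = {x. x = (\<Sum>b\<in>B. cinner x b *\<^sub>C b)}"
    using orthonormal_expansion[OF assms] by blast
  moreover have "closed {x. x = (\<Sum>b\<in>B. cinner x b *\<^sub>C b)}"
    by (intro closed_Collect_eq continuous_on_id continuous_on_sum
        bounded_linear.continuous_on[OF bounded_linear_scaleC_left] continuous_on_cinner_left)
  ultimately show ?thesis by simp
qed

lemma maximal_orthonormal:
  fixes M :: "'a::chilbert_space set"
  assumes M: "csubspace M"
  shows "\<exists>B\<subseteq>M. orthonormal B \<and> (\<forall>x\<in>M. (\<forall>b\<in>B. cinner x b = 0) \<longrightarrow> x = 0)"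
proof -
  define S where "S = {B. B \<subseteq> M \<and> orthonormal B}"
  have "\<Union>C \<in> S" if C: "subset.chain S C" for C
  proof -
    have "cinner x y = (if x = y then 1 else 0)" if "x \<in> X" "X \<in> C" "y \<in> Y" "Y \<in> C" for x y X Y
    proof -
      have "X \<subseteq> Y \<or> Y \<subseteq> X" using C that unfolding subset.chain_def by blast
      then obtain Z where "Z \<in> C" "x \<in> Z" "y \<in> Z" using \<open>x \<in> X\<close> \<open>X \<in> C\<close> \<open>y \<in> Y\<close> \<open>Y \<in> C\<close> by blast
      then show ?thesis using C unfolding subset.chain_def S_def orthonormal_def by blast
    qed
    then have "orthonormal (\<Union>C)" unfolding orthonormal_def by (meson UnionE)
    moreover have "\<Union>C \<subseteq> M" using C unfolding subset.chain_def S_def by blast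
    ultimately show ?thesis unfolding S_def by simp
  qed
  from subset_Zorn'[OF this] obtain B where B: "B \<in> S" "\<And>X. X \<in> S \<Longrightarrow> B \<subseteq> X \<Longrightarrow> X = B" by blast
  have "x = 0" if x: "x \<in> M" "\<forall>b\<in>B. cinner x b = 0" for x
  proof (rule ccontr)
    assume nz: "x \<noteq> 0"
    define e where "e = complex_of_real (inverse (norm x)) *\<^sub>C x"
    have e1: "cinner e e = 1"
    proof -
      have "norm e = 1" unfolding e_def norm_scaleC using nz by (simp add: norm_inverse)
      then show ?thesis by (simp add: cinner_self)
    qed
    have e0: "cinner e b = 0" "cinner b e = 0" if "b \<in> B" for b
      using x(2) that cinner_commute[of b x] unfolding e_def by (simp_all add: cinner_scaleC_left cinner_scaleC_right)
    have "e \<in> M" unfolding e_def using x M complex_vector.subspace_scale by blast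
    then have "insert e B \<in> S" using B(1) e0 e1 unfolding S_def orthonormal_def by auto
    from B(2)[OF this] have "e \<in> B" by blast
    then show False using e0[of e] e1 by simp
  qed
  then show ?thesis using B(1) unfolding S_def by blast
qed

lemma hilbert_closure_cspan:
  fixes B :: "'a::chilbert_space set"
  shows "hilbert (closure (cspan B))"
  unfolding hilbert_def
proof
  let ?S = "cspan B"
  show "csubspace (closure ?S)"
  proof (rule complex_vector.subspaceI)
    show "0 \<in> closure ?S" using closure_subset complex_vector.span_zero by blast
    show "x + y \<in> closure ?S" if "x \<in> closure ?S" "y \<in> closure ?S" for x y
    proof -
      from that obtain f g where f: "\<forall>n. f n \<in> ?S" "f \<longlonglongrightarrow> x" and g: "\<forall>n. g n \<in> ?S" "g \<longlonglongrightarrow> y"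
        unfolding closure_sequential by blast
      show ?thesis unfolding closure_sequential
        using f g tendsto_add[OF f(2) g(2)] complex_vector.span_add
        by (intro exI[of _ "\<lambda>n. f n + g n"]) blast
    qed
    show "c *\<^sub>C x \<in> closure ?S" if x: "x \<in> closure ?S" for c x
    proof -
      from x obtain f where f: "\<forall>n. f n \<in> ?S" "f \<longlonglongrightarrow> x" unfolding closure_sequential by blast
      show ?thesis unfolding closure_sequential
        using f bounded_linear.tendsto[OF bounded_linear_scaleC f(2)] complex_vector.span_scale
        by (intro exI[of _ "\<lambda>n. c *\<^sub>C f n"]) blast
    qed
  qed
qed simp

lemma orthonormal_basis_iff:
  "orthonormal_basis B M \<longleftrightarrow> B \<subseteq> M \<and> orthonormal B \<and> M \<subseteq> closure (cspan B)"
  unfolding orthonormal_basis_def orthonormal_def by blast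

text \<open>
  Take a maximal orthonormal set. The difference between a vector of \<open>M\<close> and its projection onto the closed span is
  orthogonal to the set, so it vanishes.
\<close>

lemma orthonormal_basis_exists:
  assumes "hilbert M" shows "\<exists>B. orthonormal_basis B M"
proof -
  have M: "csubspace M" "closed M" using assms by (auto simp: hilbert_def)
  obtain B where B: "B \<subseteq> M" "orthonormal B" "\<And>x. x \<in> M \<Longrightarrow> (\<forall>b\<in>B. cinner x b = 0) \<Longrightarrow> x = 0"
    using maximal_orthonormal[OF M(1)] by blast
  have sub: "closure (cspan B) \<subseteq> M"
    using B(1) M by (intro closure_minimal complex_vector.span_minimal)
  have "x \<in> closure (cspan B)" if x: "x \<in> M" for x
  proof -
    obtain m where m: "m \<in> closure (cspan B)" "\<forall>y\<in>closure (cspan B). cinner (x - m) y = 0"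
      using projection[OF hilbert_closure_cspan] by blast
    have "x - m \<in> M" using x m sub M complex_vector.subspace_diff by blast
    moreover have "\<forall>b\<in>B. cinner (x - m) b = 0"
      using m closure_subset complex_vector.span_base by blast
    ultimately have "x - m = 0" by (rule B(3))
    then show ?thesis using m by simp
  qed
  then show ?thesis using B unfolding orthonormal_basis_iff by blast
qed

lemma orthonormal_infinite_codim:
  assumes "orthonormal B" "B \<subseteq> M" "infinite B" "csubspace M"
  shows "codim M {0} = \<infinity>"
  using codim_infinite[OF complex_vector.subspace_single_0 _ assms(2) orthonormal_indep[OF assms(1)] assms(3)]
    complex_vector.subspace_0[OF assms(4)] by simp

definition card_enat :: "'a rel \<Rightarrow> enat" where
  "card_enat r = (if cfinite r then enat (card (Field r)) else \<infinity>)"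

lemma ereal_of_card_eq: "ereal_of_card r = ereal_of_enat (card_enat r)"
  unfolding ereal_of_card_def card_enat_def by simp

lemma cfinite_iff: "cfinite r \<longleftrightarrow> card_enat r \<noteq> \<infinity>"
  unfolding card_enat_def by simp

lemma card_enat_card_of: "card_enat |B| = (if finite B then enat (card B) else \<infinity>)"
  unfolding card_enat_def BNF_Cardinal_Arithmetic.cfinite_def by (simp add: Field_card_of)

text \<open>
  An infinite orthonormal basis is no algebraic basis, but it is linearly independent, and so the algebraic
  dimension is infinite too.
\<close>

lemma card_enat_hilbert_dim:
  assumes "hilbert M" shows "card_enat (hilbert_dim M) = codim M {0}"
proof -
  have M: "csubspace M" using assms by (auto simp: hilbert_def)
  define B where "B = (SOME B. orthonormal_basis B M)"
  have "orthonormal_basis B M"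
    unfolding B_def by (rule someI_ex[OF orthonormal_basis_exists[OF assms]])
  then have B: "B \<subseteq> M" "orthonormal B" "M \<subseteq> closure (cspan B)"
    unfolding orthonormal_basis_iff by auto
  have "codim M {0} = (if finite B then enat (card B) else \<infinity>)"
  proof (cases "finite B")
    case True
    then have "M \<subseteq> cspan B" using B closed_cspan_orthonormal by (metis closure_closed)
    then have "quotient_basis B M {0}"
      unfolding quotient_basis_iff using B orthonormal_indep by force
    from codim_eq[OF complex_vector.subspace_single_0 this] show ?thesis .
  next
    case False
    then show ?thesis using orthonormal_infinite_codim B M by auto
  qed
  then show ?thesis unfolding hilbert_dim_def B_def[symmetric] by (simp add: card_enat_card_of)
qed

lemma card_enat_quotient_dim:
  assumes "csubspace M" "M \<subseteq> V" shows "card_enat (quotient_dim V M) = codim V M"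
  unfolding quotient_dim_def card_enat_card_of
  using codim_eq[OF assms(1) someI_ex[OF quotient_basis_exists[OF assms]]] by simp

lemma csubspace_orth_compl:
  assumes "csubspace H" shows "csubspace (orth_compl H M)"
  using assms unfolding orth_compl_def
  by (intro complex_vector.subspaceI)
     (auto simp: cinner_add_left cinner_scaleC_left complex_vector.subspace_0 complex_vector.subspace_add
       complex_vector.subspace_scale)

lemma hilbert_orth_compl:
  assumes "hilbert H" shows "hilbert (orth_compl H M)"
proof -
  have "orth_compl H M = H \<inter> (\<Inter>y\<in>M. {x. cinner x y = 0})" unfolding orth_compl_def by blast
  moreover have "closed (H \<inter> (\<Inter>y\<in>M. {x. cinner x y = 0}))"
    using assms unfolding hilbert_def
    by (intro closed_Int closed_INT ballI closed_Collect_eq continuous_on_cinner_left continuous_on_const) auto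
  ultimately show ?thesis using csubspace_orth_compl[of H M] assms unfolding hilbert_def by metis
qed

lemma orth_decomp:
  assumes "hilbert M" "csubspace H" "M \<subseteq> H" "x \<in> H"
  obtains u v where "u \<in> M" "v \<in> orth_compl H M" "x = u + v"
proof -
  obtain m where m: "m \<in> M" "\<forall>y\<in>M. cinner (x - m) y = 0" using projection[OF assms(1)] by blast
  have "x - m \<in> H" using m assms complex_vector.subspace_diff by blast
  then show ?thesis using m that[of m "x - m"] by (simp add: orth_compl_def)
qed

lemma orth_disjoint: "x \<in> M \<Longrightarrow> x \<in> orth_compl H M \<Longrightarrow> x = 0"
  unfolding orth_compl_def by (auto simp: cinner_self)

lemma codim_orth_compl:
  assumes M: "hilbert M" and H: "csubspace H" and MH: "M \<subseteq> H"
  shows "codim H M = codim (orth_compl H M) {0}"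
proof -
  have Ms: "csubspace M" using M by (simp add: hilbert_def)
  have Os: "csubspace (orth_compl H M)" using csubspace_orth_compl[OF H] .
  have "H = {x + y |x y. x \<in> M \<and> y \<in> orth_compl H M}"
  proof
    show "H \<subseteq> {x + y |x y. x \<in> M \<and> y \<in> orth_compl H M}" using orth_decomp[OF M H MH] by blast
    show "{x + y |x y. x \<in> M \<and> y \<in> orth_compl H M} \<subseteq> H"
      using MH complex_vector.subspace_add[OF H] by (auto simp: orth_compl_def)
  qed
  moreover have "orth_compl H M \<inter> M = {0}"
    using orth_disjoint complex_vector.subspace_0[OF Ms] complex_vector.subspace_0[OF Os] by blast
  ultimately show ?thesis using codim_sum[OF Ms Os] by simp
qed

section \<open>Nullity and defect of a bounded operator\<close>

lemma bounded_ops_clinear: "T \<in> bounded_ops H K \<Longrightarrow> clinear_on H T"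
  unfolding bounded_ops_def clinear_on_def by blast

lemma bounded_ops_continuous:
  assumes T: "T \<in> bounded_ops H K" and H: "csubspace H" shows "continuous_on H T"
proof -
  obtain C where C: "\<And>x. x \<in> H \<Longrightarrow> norm (T x) \<le> C * norm x" using T unfolding bounded_ops_def by blast
  have "dist (T x) (T y) \<le> \<bar>C\<bar> * dist x y" if "x \<in> H" "y \<in> H" for x y
  proof -
    have "dist (T x) (T y) \<le> C * norm (x - y)"
      unfolding dist_norm using clinear_on_diff[OF bounded_ops_clinear[OF T] H that] C[of "x - y"]
        complex_vector.subspace_diff[OF H that] by simp
    also have "\<dots> \<le> \<bar>C\<bar> * norm (x - y)" by (intro mult_right_mono) auto
    finally show ?thesis by (simp add: dist_norm)
  qed
  then have "\<bar>C\<bar>-lipschitz_on H T" by (intro lipschitz_onI) auto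
  then show ?thesis by (rule lipschitz_on_continuous_on)
qed

lemma hilbert_ker:
  assumes T: "T \<in> bounded_ops H K" and H: "hilbert H" shows "hilbert (ker H T)"
proof -
  have s: "csubspace H" "closed H" using H by (auto simp: hilbert_def)
  have "closedin (top_of_set H) (H \<inter> T -` {0})"
    using bounded_ops_continuous[OF T s(1)] by (intro continuous_closedin_preimage) auto
  moreover have "H \<inter> T -` {0} = ker H T" by (auto simp: ker_def)
  ultimately have "closed (ker H T)" using s(2) closedin_closed_trans by metis
  then show ?thesis using csubspace_ker[OF bounded_ops_clinear[OF T] s(1)] by (simp add: hilbert_def)
qed

lemma bounded_ops_range:
  assumes "T \<in> bounded_ops H K" shows "T ` H \<subseteq> K"
  using assms unfolding bounded_ops_def by blast

lemma card_enat_alpha: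
  assumes "T \<in> bounded_ops H H" "hilbert H"
  shows "card_enat (alpha H T) = codim (ker H T) {0}"
  unfolding alpha_def by (intro card_enat_hilbert_dim hilbert_ker[OF assms])

text \<open>
  If the range is closed, its orthogonal complement is a linear complement and represents the quotient;
  otherwise the defect is the algebraic codimension by definition.
\<close>

lemma card_enat_beta:
  assumes T: "T \<in> bounded_ops H H" and H: "hilbert H"
  shows "card_enat (beta H T) = codim H (T ` H)"
proof -
  have s: "csubspace H" using H by (auto simp: hilbert_def)
  have R: "csubspace (T ` H)" using csubspace_image[OF bounded_ops_clinear[OF T] s] .
  show ?thesis
  proof (cases "closed (T ` H)")
    case True
    then have "hilbert (T ` H)" using R by (simp add: hilbert_def)
    then show ?thesis
      unfolding beta_def using True codim_orth_compl[OF _ s bounded_ops_range[OF T]]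
        card_enat_hilbert_dim[OF hilbert_orth_compl[OF H]] by simp
  next
    case False
    then show ?thesis unfolding beta_def using card_enat_quotient_dim[OF R bounded_ops_range[OF T]] by simp
  qed
qed

section \<open>Partial isometries between closed subspaces\<close>

lemma closure_cspan_subset:
  assumes "hilbert N" "E \<subseteq> N" shows "closure (cspan E) \<subseteq> N"
  using assms unfolding hilbert_def by (intro closure_minimal complex_vector.span_minimal) auto

text \<open>
  Orthogonality to \<open>x\<close> is a closed linear condition.
\<close>

lemma orthogonal_closure_cspan:
  fixes x :: "'a::chilbert_space"
  assumes "\<And>e. e \<in> E \<Longrightarrow> cinner x e = 0" "y \<in> closure (cspan E)"
  shows "cinner x y = 0"
proof -
  let ?Z = "{y. cinner y x = 0}"
  have sym: "cinner x y = 0 \<longleftrightarrow> cinner y x = 0" for y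
    using cinner_commute[of x y] cinner_commute[of y x] by auto
  have "hilbert ?Z"
    unfolding hilbert_def
  proof
    show "csubspace ?Z"
      by (intro complex_vector.subspaceI) (auto simp: cinner_add_left cinner_scaleC_left)
    show "closed ?Z" by (intro closed_Collect_eq continuous_on_cinner_left continuous_on_const)
  qed
  moreover have "E \<subseteq> ?Z" using assms(1) sym by blast
  ultimately show ?thesis using closure_cspan_subset assms(2) sym by blast
qed

text \<open>
  The foot of the perpendicular is unique, which makes it depend linearly on the point.
\<close>

lemma orthogonal_projection:
  fixes W :: "'a::chilbert_space set"
  assumes W: "hilbert W"
  shows "\<exists>P. (\<forall>x. P x \<in> W) \<and> (\<forall>x y. P (x + y) = P x + P y) \<and> (\<forall>c x. P (c *\<^sub>C x) = c *\<^sub>C P x)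
    \<and> (\<forall>x. norm (P x) \<le> norm x) \<and> (\<forall>x\<in>W. P x = x) \<and> (\<forall>x. (\<forall>y\<in>W. cinner x y = 0) \<longrightarrow> P x = 0)"
proof -
  have s: "csubspace W" using W by (simp add: hilbert_def)
  obtain P where P: "\<And>x. P x \<in> W" "\<And>x y. y \<in> W \<Longrightarrow> cinner (x - P x) y = 0"
    using projection[OF W] by metis
  have uniq: "P x = m" if m: "m \<in> W" "\<And>y. y \<in> W \<Longrightarrow> cinner (x - m) y = 0" for x m
  proof -
    have d: "P x - m \<in> W" using complex_vector.subspace_diff[OF s P(1) m(1)] .
    have "cinner (P x - m) (P x - m) = cinner (x - m) (P x - m) - cinner (x - P x) (P x - m)"
      unfolding cinner_diff_left by simp
    then have "cinner (P x - m) (P x - m) = 0" using P(2)[OF d] m(2)[OF d] by simp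
    then show ?thesis by (simp add: cinner_self)
  qed
  have "P (x + y) = P x + P y" for x y
  proof (rule uniq)
    show "P x + P y \<in> W" using complex_vector.subspace_add[OF s P(1) P(1)] .
    show "cinner (x + y - (P x + P y)) z = 0" if "z \<in> W" for z
      using P(2)[OF that, of x] P(2)[OF that, of y] by (simp add: cinner_add_left cinner_diff_left)
  qed
  moreover have "P (c *\<^sub>C x) = c *\<^sub>C P x" for c x
  proof (rule uniq)
    show "c *\<^sub>C P x \<in> W" using complex_vector.subspace_scale[OF s P(1)] .
    show "cinner (c *\<^sub>C x - c *\<^sub>C P x) z = 0" if "z \<in> W" for z
      using P(2)[OF that, of x] by (simp add: cinner_diff_left cinner_scaleC_left)
  qed
  moreover have "norm (P x) \<le> norm x" for x
  proof -
    have "inner (x - P x) (P x) = 0" using P(2)[OF P(1), of x x] by (simp add: inner_eq_Re_cinner)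
    then have "norm (P x) * norm (P x) = inner x (P x)"
      by (simp add: inner_diff_left power2_norm_eq_inner[symmetric] power2_eq_square)
    also have "\<dots> \<le> norm x * norm (P x)" by (rule norm_cauchy_schwarz)
    finally show ?thesis by (cases "P x = 0") auto
  qed
  moreover have "P x = x" if "x \<in> W" for x by (rule uniq) (use that in auto)
  moreover have "P x = 0" if "\<forall>y\<in>W. cinner x y = 0" for x
    by (rule uniq) (use that complex_vector.subspace_0[OF s] in auto)
  ultimately show ?thesis using P(1) by blast
qed

lemma norm_orthonormal_family:
  fixes g :: "'b \<Rightarrow> 'a::complex_inner"
  assumes "finite F" "\<And>x y. x \<in> F \<Longrightarrow> y \<in> F \<Longrightarrow> cinner (g x) (g y) = (if x = y then 1 else 0)"
  shows "(norm (\<Sum>x\<in>F. c x *\<^sub>C g x))\<^sup>2 = (\<Sum>x\<in>F. (cmod (c x))\<^sup>2)"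
proof -
  have "cinner (g y) (\<Sum>x\<in>F. c x *\<^sub>C g x) = cnj (c y)" if y: "y \<in> F" for y
  proof -
    have "cinner (\<Sum>x\<in>F. c x *\<^sub>C g x) (g y) = (\<Sum>x\<in>F. if x = y then c x else 0)"
      unfolding cinner_sum_left cinner_scaleC_left using assms(2) y by (intro sum.cong) auto
    also have "\<dots> = c y" using assms(1) y by simp
    finally show ?thesis using cinner_commute[of "g y" "\<Sum>x\<in>F. c x *\<^sub>C g x"] by simp
  qed
  then have "cinner (\<Sum>x\<in>F. c x *\<^sub>C g x) (\<Sum>x\<in>F. c x *\<^sub>C g x) = (\<Sum>x\<in>F. c x * cnj (c x))"
    by (subst cinner_sum_left) (auto simp: cinner_scaleC_left intro!: sum.cong)
  also have "\<dots> = complex_of_real (\<Sum>x\<in>F. (cmod (c x))\<^sup>2)"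
    by (simp only: complex_norm_square of_real_sum)
  finally show ?thesis unfolding cinner_self using of_real_eq_iff by blast
qed

text \<open>
  Extend \<open>g\<close> linearly to the span of \<open>E\<close>; by Pythagoras this preserves norms, so it extends continuously to the
  closure. Its image is complete and contains \<open>B\<close>, hence it is everything.
\<close>

lemma isometry_exists:
  fixes g :: "'a::chilbert_space \<Rightarrow> 'b::chilbert_space"
  assumes E: "orthonormal E" and B: "orthonormal B" and g: "bij_betw g E B"
  shows "\<exists>V\<in>bounded_ops (closure (cspan E)) (closure (cspan B)). V ` closure (cspan E) = closure (cspan B)"
proof -
  interpret cp: vector_space_pair "scaleC :: complex \<Rightarrow> 'a \<Rightarrow> 'a" "scaleC :: complex \<Rightarrow> 'b \<Rightarrow> 'b"
    by unfold_locales
  have "complex_vector.independent E"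
    unfolding complex_vector.independent_explicit_finite_subsets
    using orthonormal_indep[OF E] unfolding indep_mod_def by blast
  from cp.linear_independent_extend[OF this, of g]
  obtain L where L: "Vector_Spaces.linear scaleC scaleC L" "\<And>x. x \<in> E \<Longrightarrow> L x = g x" by blast
  interpret L: Vector_Spaces.linear "scaleC :: complex \<Rightarrow> 'a \<Rightarrow> 'a" "scaleC :: complex \<Rightarrow> 'b \<Rightarrow> 'b" L by fact
  let ?S = "cspan E"
  have Lspan: "L ` ?S = cspan B"
    using L.span_image[of E, folded cspan_def] L(2) g unfolding bij_betw_def by (simp cong: image_cong)
  have isoL: "norm (L x) = norm x" if x: "x \<in> ?S" for x
  proof -
    obtain F c where F: "finite F" "F \<subseteq> E" "x = (\<Sum>a\<in>F. c a *\<^sub>C a)"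
      using x unfolding complex_vector.span_explicit by blast
    have "L x = (\<Sum>a\<in>F. c a *\<^sub>C g a)"
      unfolding F(3) L.sum L.scale using F(2) L(2) by (intro sum.cong) auto
    moreover have "(norm (\<Sum>a\<in>F. c a *\<^sub>C g a))\<^sup>2 = (\<Sum>a\<in>F. (cmod (c a))\<^sup>2)"
    proof (rule norm_orthonormal_family[OF F(1)])
      fix a b assume "a \<in> F" "b \<in> F"
      then have "a \<in> E" "b \<in> E" using F by auto
      then have "g a \<in> B" "g b \<in> B" "g a = g b \<longleftrightarrow> a = b" using g unfolding bij_betw_def inj_on_def by auto
      then show "cinner (g a) (g b) = (if a = b then 1 else 0)" using B unfolding orthonormal_def by simp
    qed
    moreover have "(norm (\<Sum>a\<in>F. c a *\<^sub>C a))\<^sup>2 = (\<Sum>a\<in>F. (cmod (c a))\<^sup>2)"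
      using norm_orthonormal_family[OF F(1), of "\<lambda>a. a" c] E F(2) unfolding orthonormal_def by blast
    ultimately have "(norm (L x))\<^sup>2 = (norm x)\<^sup>2" using F(3) by simp
    then show ?thesis by simp
  qed
  have distL: "dist (L x) (L y) = dist x y" if "x \<in> ?S" "y \<in> ?S" for x y
    unfolding dist_norm using isoL[OF complex_vector.span_diff[OF that]] by (simp add: L.diff)
  have "uniformly_continuous_on ?S L"
    unfolding uniformly_continuous_on_def using distL by (metis)
  then obtain V where V: "uniformly_continuous_on (closure ?S) V" "\<And>x. x \<in> ?S \<Longrightarrow> L x = V x"
    by (rule uniformly_continuous_on_extension_on_closure) (rule that, assumption, simp)
  have lim: "(\<lambda>n. L (f n)) \<longlonglongrightarrow> V x" if "\<And>n. f n \<in> ?S" "f \<longlonglongrightarrow> x" for f x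
  proof -
    have x: "x \<in> closure ?S" unfolding closure_sequential using that by (intro exI[of _ f]) simp
    have "f n \<in> closure ?S" for n using that(1)[of n] by (rule subsetD[OF closure_subset])
    then have "(\<lambda>n. V (f n)) \<longlonglongrightarrow> V x"
      using continuous_on_tendsto_compose[OF uniformly_continuous_imp_continuous[OF V(1)] that(2) x] by simp
    then show ?thesis using V(2)[OF that(1)] by simp
  qed
  have range: "V x \<in> closure (cspan B)" and norm: "norm (V x) = norm x" if x: "x \<in> closure ?S" for x
  proof -
    obtain f where f: "\<And>n. f n \<in> ?S" "f \<longlonglongrightarrow> x" using x unfolding closure_sequential by blast
    have "L (f n) \<in> cspan B" for n using f(1) Lspan by blast
    with lim[OF f] show "V x \<in> closure (cspan B)" unfolding closure_sequential
      by (intro exI[of _ "\<lambda>n. L (f n)"]) simp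
    have "(\<lambda>n. norm (f n)) \<longlonglongrightarrow> norm (V x)" using tendsto_norm[OF lim[OF f]] isoL[OF f(1)] by simp
    then show "norm (V x) = norm x" using tendsto_norm[OF f(2)] LIMSEQ_unique by blast
  qed
  have add: "V (x + y) = V x + V y" if xy: "x \<in> closure ?S" "y \<in> closure ?S" for x y
  proof -
    obtain f where f: "\<And>n. f n \<in> ?S" "f \<longlonglongrightarrow> x" using xy(1) unfolding closure_sequential by blast
    obtain h where h: "\<And>n. h n \<in> ?S" "h \<longlonglongrightarrow> y" using xy(2) unfolding closure_sequential by blast
    have "(\<lambda>n. L (f n + h n)) \<longlonglongrightarrow> V (x + y)"
      using lim[OF complex_vector.span_add[OF f(1) h(1)] tendsto_add[OF f(2) h(2)]] .
    moreover have "(\<lambda>n. L (f n + h n)) \<longlonglongrightarrow> V x + V y"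
      using tendsto_add[OF lim[OF f] lim[OF h]] by (simp add: L.add)
    ultimately show ?thesis by (rule LIMSEQ_unique)
  qed
  have scale: "V (c *\<^sub>C x) = c *\<^sub>C V x" if x: "x \<in> closure ?S" for c x
  proof -
    obtain f where f: "\<And>n. f n \<in> ?S" "f \<longlonglongrightarrow> x" using x unfolding closure_sequential by blast
    have "(\<lambda>n. L (c *\<^sub>C f n)) \<longlonglongrightarrow> V (c *\<^sub>C x)"
      using lim[OF complex_vector.span_scale[OF f(1)] bounded_linear.tendsto[OF bounded_linear_scaleC f(2)]] .
    moreover have "(\<lambda>n. L (c *\<^sub>C f n)) \<longlonglongrightarrow> c *\<^sub>C V x"
      using bounded_linear.tendsto[OF bounded_linear_scaleC lim[OF f]] by (simp add: L.scale)
    ultimately show ?thesis by (rule LIMSEQ_unique)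
  qed
  have "y \<in> V ` closure ?S" if y: "y \<in> closure (cspan B)" for y
  proof -
    obtain h where h: "\<And>n. h n \<in> cspan B" "h \<longlonglongrightarrow> y" using y unfolding closure_sequential by blast
    have "\<forall>n. \<exists>x\<in>?S. L x = h n" using h(1) Lspan by (metis imageE)
    then obtain f where f: "\<And>n. f n \<in> ?S" "\<And>n. L (f n) = h n" by metis
    have "Cauchy h" using h(2) LIMSEQ_imp_Cauchy by blast
    then have "Cauchy f" unfolding Cauchy_def f(2)[symmetric] distL[OF f(1) f(1)] .
    then obtain x where x: "f \<longlonglongrightarrow> x" by (metis Cauchy_convergent_iff convergentD)
    have "h \<longlonglongrightarrow> V x" using lim[OF f(1) x] f(2) by simp
    then have "V x = y" using h(2) LIMSEQ_unique by blast
    moreover have "x \<in> closure ?S" unfolding closure_sequential using f(1) x by (intro exI[of _ f]) simp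
    ultimately show ?thesis by blast
  qed
  then have "V ` closure ?S = closure (cspan B)" using range by blast
  moreover have "V \<in> bounded_ops (closure ?S) (closure (cspan B))"
    unfolding bounded_ops_def using range add scale norm by (auto intro!: exI[of _ 1])
  ultimately show ?thesis by blast
qed

text \<open>
  If \<open>C\<close> is infinite, it has room for the disjoint union of \<open>B\<close> and the natural numbers; the
  image of the latter is left over.
\<close>

lemma injection_infinite_rest:
  assumes "|B| \<le>o |C|"
  shows "\<exists>f. inj_on f B \<and> f ` B \<subseteq> C \<and> (infinite C \<longrightarrow> infinite (C - f ` B))"
proof (cases "finite C")
  case True
  then show ?thesis using assms unfolding card_of_ordLeq[symmetric] by blast
next
  case False
  then have "|UNIV :: nat set| \<le>o |C|" using infinite_iff_card_of_nat by blast
  then have "|B <+> (UNIV :: nat set)| \<le>o |C|"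
    using card_of_Plus_ordLeq_infinite_Field[OF _ assms _ card_of_Card_order] False by (simp add: Field_card_of)
  then obtain h where h: "inj_on h (B <+> (UNIV :: nat set))" "h ` (B <+> (UNIV :: nat set)) \<subseteq> C"
    unfolding card_of_ordLeq[symmetric] by blast
  define f where "f = h \<circ> Inl"
  have "inj_on f B" unfolding f_def using h(1) by (auto simp: inj_on_def)
  moreover have "f ` B \<subseteq> C" unfolding f_def using h(2) by auto
  moreover have "infinite (C - f ` B)"
  proof
    assume "finite (C - f ` B)"
    moreover have "range (h \<circ> Inr) \<subseteq> C - f ` B"
    proof
      fix x assume "x \<in> range (h \<circ> Inr)"
      then obtain n where n: "x = h (Inr n)" by auto
      then have "x \<in> C" using h(2) by auto
      moreover have "x \<noteq> f b" if "b \<in> B" for b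
        using inj_onD[OF h(1), of "Inr n" "Inl b"] n that unfolding f_def by auto
      ultimately show "x \<in> C - f ` B" by blast
    qed
    moreover have "infinite (range (h \<circ> (Inr :: nat \<Rightarrow> _)))"
      using h(1) by (intro range_inj_infinite) (auto simp: inj_on_def)
    ultimately show False using finite_subset by blast
  qed
  ultimately show ?thesis by blast
qed

text \<open>
  Project orthogonally onto the closed span of \<open>f ` B\<close>, then map it isometrically onto \<open>R\<close>. The basis
  vectors in \<open>C\<close> outside \<open>f ` B\<close> are killed by the projection.
\<close>

lemma coisometry_exists:
  fixes H :: "'a::chilbert_space set" and R :: "'b::chilbert_space set"
  assumes H: "hilbert H" and N: "hilbert N" "N \<subseteq> H" and R: "hilbert R"
    and C: "orthonormal_basis C N" and B: "orthonormal_basis B R"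
    and le: "\<exists>f. inj_on f B \<and> f ` B \<subseteq> C \<and> (infinite C \<longrightarrow> infinite (C - f ` B))"
  shows "\<exists>A\<in>bounded_ops H R. A ` N = R \<and> (\<forall>x\<in>orth_compl H N. A x = 0)
    \<and> (infinite C \<longrightarrow> (\<exists>E\<subseteq>N. orthonormal E \<and> infinite E \<and> (\<forall>x\<in>E. A x = 0)))"
proof -
  obtain f where f: "inj_on f B" "f ` B \<subseteq> C" "infinite C \<Longrightarrow> infinite (C - f ` B)" using le by blast
  have C': "C \<subseteq> N" "orthonormal C" using C unfolding orthonormal_basis_iff by auto
  have B': "B \<subseteq> R" "orthonormal B" "R \<subseteq> closure (cspan B)" using B unfolding orthonormal_basis_iff by auto
  have clB: "closure (cspan B) = R" using B' closure_cspan_subset[OF R B'(1)] by blast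
  define E where "E = f ` B"
  define W where "W = closure (cspan E)"
  have E: "orthonormal E" "E \<subseteq> N" using f C' orthonormal_subset unfolding E_def by blast+
  have "bij_betw (inv_into B f) E B"
    unfolding E_def using f(1) by (simp add: bij_betw_inv_into inj_on_imp_bij_betw)
  from isometry_exists[OF E(1) B'(2) this]
  obtain V where V: "V \<in> bounded_ops W R" "V ` W = R" unfolding W_def clB by blast
  have W: "hilbert W" unfolding W_def by (rule hilbert_closure_cspan)
  have WN: "W \<subseteq> N" unfolding W_def by (rule closure_cspan_subset[OF N(1) E(2)])
  have Ws: "csubspace W" using W by (simp add: hilbert_def)
  have V0: "V 0 = 0" using clinear_on_0[OF bounded_ops_clinear[OF V(1)] Ws] .
  obtain P where P: "\<And>x. P x \<in> W" "\<And>x y. P (x + y) = P x + P y" "\<And>c x. P (c *\<^sub>C x) = c *\<^sub>C P x"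
    "\<And>x. norm (P x) \<le> norm x" "\<And>x. x \<in> W \<Longrightarrow> P x = x" "\<And>x. (\<forall>y\<in>W. cinner x y = 0) \<Longrightarrow> P x = 0"
    using orthogonal_projection[OF W] by metis
  define A where "A x = V (P x)" for x
  obtain K where K: "\<And>x. x \<in> W \<Longrightarrow> norm (V x) \<le> K * norm x" using V(1) unfolding bounded_ops_def by blast
  have bound: "norm (A x) \<le> \<bar>K\<bar> * norm x" for x
  proof -
    have "norm (A x) \<le> K * norm (P x)" unfolding A_def using K[OF P(1)] .
    also have "\<dots> \<le> \<bar>K\<bar> * norm x" using P(4) by (intro mult_mono) auto
    finally show ?thesis .
  qed
  have AR: "A x \<in> R" for x unfolding A_def using P(1) V(2) by blast
  have "A \<in> bounded_ops H R"
    unfolding bounded_ops_def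
  proof (intro CollectI conjI ballI allI)
    show "A (x + y) = A x + A y" for x y
      unfolding A_def P(2) by (rule clinear_on_add[OF bounded_ops_clinear[OF V(1)] P(1) P(1)])
    show "A (c *\<^sub>C x) = c *\<^sub>C A x" for c x
      unfolding A_def P(3) by (rule clinear_on_scale[OF bounded_ops_clinear[OF V(1)] P(1)])
    show "\<exists>C. \<forall>x\<in>H. norm (A x) \<le> C * norm x" using bound by blast
  qed (rule AR)
  moreover have "A ` N = R"
  proof
    show "R \<subseteq> A ` N"
    proof
      fix y assume "y \<in> R"
      then obtain x where x: "x \<in> W" "y = V x" using V(2) by blast
      then have "y = A x" unfolding A_def using P(5) by simp
      then show "y \<in> A ` N" using x WN by blast
    qed
  qed (use AR in blast)
  moreover have "A x = 0" if "x \<in> orth_compl H N" for x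
  proof -
    have "\<forall>y\<in>W. cinner x y = 0" using that WN unfolding orth_compl_def by auto
    then show ?thesis unfolding A_def using P(6) V0 by simp
  qed
  moreover have "\<exists>E\<subseteq>N. orthonormal E \<and> infinite E \<and> (\<forall>x\<in>E. A x = 0)" if "infinite C"
  proof (intro exI conjI ballI)
    show "C - f ` B \<subseteq> N" using C' by blast
    show "orthonormal (C - f ` B)" using C'(2) orthonormal_subset by blast
    show "infinite (C - f ` B)" using f(3) that .
    fix x assume x: "x \<in> C - f ` B"
    have "cinner x e = 0" if "e \<in> E" for e
    proof -
      have "e \<in> C" "e \<noteq> x" using that x f(2) unfolding E_def by auto
      then show ?thesis using C'(2) x unfolding orthonormal_def by simp
    qed
    then have "\<forall>y\<in>W. cinner x y = 0" unfolding W_def using orthogonal_closure_cspan by blast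
    then show "A x = 0" using P(6) V0 unfolding A_def by simp
  qed
  ultimately show ?thesis by blast
qed

section \<open>Upper triangular block operators\<close>

lemma scaleC_vec_nth [simp]: "(c *\<^sub>C x) $ i = c *\<^sub>C (x $ i)"
  by (simp add: scaleC_vec_def)

lemma hilbert_hilbert_sum:
  assumes "\<And>s. hilbert (H s)" shows "hilbert (hilbert_sum H)"
  unfolding hilbert_def
proof
  have s: "csubspace (H s)" "closed (H s)" for s using assms[of s] by (auto simp: hilbert_def)
  show "csubspace (hilbert_sum H)"
    unfolding hilbert_sum_def
    by (intro complex_vector.subspaceI)
       (auto intro: complex_vector.subspace_0 complex_vector.subspace_add complex_vector.subspace_scale s)
  have "hilbert_sum H = (\<Inter>s. (\<lambda>x. x $ s) -` H s)" unfolding hilbert_sum_def by auto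
  moreover have "closed (\<Inter>s. (\<lambda>x. x $ s) -` H s)"
    by (intro closed_INT ballI closed_vimage s continuous_on_component continuous_on_id)
  ultimately show "closed (hilbert_sum H)" by simp
qed

locale block_operator =
  fixes H :: "'n::{finite,linorder} \<Rightarrow> 'a::chilbert_space set" and D :: "'n \<Rightarrow> 'a \<Rightarrow> 'a"
    and A :: "'n \<Rightarrow> 'n \<Rightarrow> 'a \<Rightarrow> 'a"
  assumes H: "\<And>s. hilbert (H s)" and D: "\<And>s. D s \<in> bounded_ops (H s) (H s)"
    and A: "A \<in> block_tuples H"
begin

abbreviation T where "T \<equiv> upper_tri D A"

lemma Hs: "csubspace (H s)" and Hc: "closed (H s)"
  using H[of s] by (auto simp: hilbert_def)

lemma A_ops: "i < j \<Longrightarrow> A i j \<in> bounded_ops (H j) (H i)"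
  using A unfolding block_tuples_def by blast

lemma D_lin: "clinear_on (H s) (D s)"
  using bounded_ops_clinear[OF D] .

lemma A_lin: "i < j \<Longrightarrow> clinear_on (H j) (A i j)"
  using bounded_ops_clinear[OF A_ops] .

lemma D_0: "D s 0 = 0" and A_0: "i < j \<Longrightarrow> A i j 0 = 0"
  using clinear_on_0[OF D_lin Hs] clinear_on_0[OF A_lin Hs] by auto

lemma T_nth: "T x $ i = D i (x $ i) + (\<Sum>j | i < j. A i j (x $ j))"
  by (simp add: upper_tri_def)

lemma sum_H: "csubspace (hilbert_sum H)"
  using hilbert_hilbert_sum[of H, OF H] by (simp add: hilbert_def)

lemma T_bounded: "T \<in> bounded_ops (hilbert_sum H) (hilbert_sum H)"
  unfolding bounded_ops_def
proof (intro CollectI conjI ballI allI)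
  fix x assume x: "x \<in> hilbert_sum H"
  then have "D i (x $ i) \<in> H i" "i < j \<Longrightarrow> A i j (x $ j) \<in> H i" for i j
    using bounded_ops_range[OF D[of i]] bounded_ops_range[OF A_ops[of i j]] by (auto simp: hilbert_sum_def)
  then have "T x $ i \<in> H i" for i
    unfolding T_nth by (intro complex_vector.subspace_add[OF Hs] complex_vector.subspace_sum[OF Hs]) auto
  then show "T x \<in> hilbert_sum H" by (simp add: hilbert_sum_def)
  show "T (c *\<^sub>C x) = c *\<^sub>C T x" for c
    using x clinear_on_scale[OF D_lin] clinear_on_scale[OF A_lin]
    by (simp add: vec_eq_iff T_nth hilbert_sum_def scaleC_add_right complex_vector.scale_sum_right)
  fix y assume y: "y \<in> hilbert_sum H"
  show "T (x + y) = T x + T y"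
    using x y clinear_on_add[OF D_lin] clinear_on_add[OF A_lin]
    by (simp add: vec_eq_iff T_nth hilbert_sum_def sum.distrib algebra_simps)
next
  have "\<forall>s. \<exists>C. \<forall>x\<in>H s. norm (D s x) \<le> C * norm x" using D unfolding bounded_ops_def by blast
  then obtain CD where CD: "\<And>s x. x \<in> H s \<Longrightarrow> norm (D s x) \<le> CD s * norm x" by metis
  have "\<forall>i j. \<exists>C. i < j \<longrightarrow> (\<forall>x\<in>H j. norm (A i j x) \<le> C * norm x)"
    using A_ops unfolding bounded_ops_def by blast
  then obtain CA where CA: "\<And>i j x. i < j \<Longrightarrow> x \<in> H j \<Longrightarrow> norm (A i j x) \<le> CA i j * norm x" by metis
  have comp: "c * norm (x $ i) \<le> \<bar>c\<bar> * norm x" for c and x :: "('a, 'n) vec" and i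
    by (intro mult_mono) (auto simp: Finite_Cartesian_Product.norm_nth_le)
  have "norm (T x) \<le> (\<Sum>i\<in>UNIV. \<bar>CD i\<bar> + (\<Sum>j | i < j. \<bar>CA i j\<bar>)) * norm x" if x: "x \<in> hilbert_sum H" for x
  proof -
    have xH: "x $ i \<in> H i" for i using x by (simp add: hilbert_sum_def)
    have "norm (T x $ i) \<le> (\<bar>CD i\<bar> + (\<Sum>j | i < j. \<bar>CA i j\<bar>)) * norm x" for i
    proof -
      have "norm (T x $ i) \<le> norm (D i (x $ i)) + (\<Sum>j | i < j. norm (A i j (x $ j)))"
        unfolding T_nth by (intro norm_triangle_le add_left_mono norm_sum)
      also have "\<dots> \<le> \<bar>CD i\<bar> * norm x + (\<Sum>j | i < j. \<bar>CA i j\<bar> * norm x)"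
        using CD[OF xH] CA[OF _ xH] by (intro add_mono sum_mono) (auto intro: order_trans[OF _ comp])
      finally show ?thesis by (simp add: distrib_right sum_distrib_right)
    qed
    then have "(\<Sum>i\<in>UNIV. norm (T x $ i)) \<le> (\<Sum>i\<in>UNIV. (\<bar>CD i\<bar> + (\<Sum>j | i < j. \<bar>CA i j\<bar>)) * norm x)"
      by (rule sum_mono)
    moreover have "norm (T x) \<le> (\<Sum>i\<in>UNIV. norm (T x $ i))"
      unfolding norm_vec_def by (intro L2_set_le_sum) auto
    ultimately show ?thesis by (simp add: sum_distrib_right)
  qed
  then show "\<exists>C. \<forall>x\<in>hilbert_sum H. norm (T x) \<le> C * norm x" by blast
qed

lemma T_lin: "clinear_on (hilbert_sum H) T"
  using bounded_ops_clinear[OF T_bounded] .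

text \<open>
  If \<open>S\<close> is an initial segment of the index set, \<open>T\<close> leaves this subspace invariant. These subspaces form the
  filtration whose successive quotients are the summands.
\<close>

definition supported :: "'n set \<Rightarrow> ('a, 'n) vec set" where
  "supported S = {x \<in> hilbert_sum H. \<forall>i. i \<notin> S \<longrightarrow> x $ i = 0}"

abbreviation nullity :: "'n set \<Rightarrow> enat" where "nullity S \<equiv> codim (ker (supported S) T) {0}"
abbreviation defect :: "'n set \<Rightarrow> enat" where "defect S \<equiv> codim (supported S) (T ` supported S)"
abbreviation diag_nullity :: "'n \<Rightarrow> enat" where "diag_nullity s \<equiv> codim (ker (H s) (D s)) {0}"
abbreviation diag_defect :: "'n \<Rightarrow> enat" where "diag_defect s \<equiv> codim (H s) (D s ` H s)"

lemma supported_subset: "supported S \<subseteq> hilbert_sum H"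
  unfolding supported_def by blast

lemma supported_UNIV: "supported UNIV = hilbert_sum H"
  unfolding supported_def by simp

lemma supported_subspace: "csubspace (supported S)"
  unfolding supported_def using sum_H
  by (intro complex_vector.subspaceI)
     (auto intro: complex_vector.subspace_0 complex_vector.subspace_add complex_vector.subspace_scale)

lemma T_supported:
  assumes "\<And>i j. j \<in> S \<Longrightarrow> i < j \<Longrightarrow> i \<in> S" shows "T ` supported S \<subseteq> supported S"
proof
  fix y assume "y \<in> T ` supported S"
  then obtain x where x: "x \<in> supported S" "y = T x" by blast
  have "T x $ i = 0" if "i \<notin> S" for i
  proof -
    have "A i j (x $ j) = 0" if "i < j" for j
    proof -
      have "x $ j = 0" using assms[of j i] that \<open>i \<notin> S\<close> x unfolding supported_def by blast
      then show ?thesis using A_0[OF that] by simp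
    qed
    then show ?thesis unfolding T_nth using x that D_0 unfolding supported_def by (simp add: sum.neutral)
  qed
  then show "y \<in> supported S" using x bounded_ops_range[OF T_bounded] unfolding supported_def by auto
qed

lemma axis_in_sum: "x \<in> H s \<Longrightarrow> axis s x \<in> hilbert_sum H"
  using complex_vector.subspace_0[OF Hs] by (auto simp: hilbert_sum_def axis_def)

text \<open>
  Apply \<open>snake\<close> to the coordinate \<open>k\<close>: its kernel is the previous step of the filtration, and it intertwines
  \<open>T\<close> with \<open>D k\<close>.
\<close>

lemma block_step:
  "\<exists>d c x. nullity {..k} = nullity {..<k} + d \<and> diag_nullity k = d + c \<and> defect {..k} = x + diag_defect k \<and> defect {..<k} = x + c"
proof -
  let ?p = "\<lambda>x :: ('a, 'n) vec. x $ k"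
  have img: "?p ` supported {..k} = H k"
  proof
    show "?p ` supported {..k} \<subseteq> H k" by (auto simp: supported_def hilbert_sum_def)
    show "H k \<subseteq> ?p ` supported {..k}"
    proof
      fix y assume "y \<in> H k"
      then have "axis k y \<in> supported {..k}" using axis_in_sum unfolding supported_def by (auto simp: axis_def)
      then show "y \<in> ?p ` supported {..k}" by (intro image_eqI[of _ _ "axis k y"]) (auto simp: axis_def)
    qed
  qed
  have "{x \<in> supported {..k}. x $ k = 0} = supported {..<k}"
    unfolding supported_def by (auto simp: less_le not_le not_less)
  then have ker: "supported {..<k} = ker (supported {..k}) ?p" unfolding ker_def by simp
  have pT: "T x $ k = D k (x $ k)" if "x \<in> supported {..k}" for x
  proof -
    have "A k j (x $ j) = 0" if "k < j" for j using that \<open>x \<in> supported {..k}\<close> A_0 unfolding supported_def by auto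
    then show ?thesis unfolding T_nth by (simp add: sum.neutral)
  qed
  have "clinear_on (supported {..k}) ?p" unfolding clinear_on_def by simp
  have "\<exists>d c x. nullity {..k} = nullity {..<k} + d \<and> codim (ker (?p ` supported {..k}) (D k)) {0} = d + c
      \<and> defect {..k} = x + codim (?p ` supported {..k}) (D k ` ?p ` supported {..k}) \<and> defect {..<k} = x + c"
  proof (rule snake[OF supported_subspace _ _ _ ker])
    show "clinear_on (supported {..k}) T" using clinear_on_subset[OF T_lin supported_subset] .
    show "clinear_on (supported {..k}) ?p" unfolding clinear_on_def by simp
    show "T ` supported {..k} \<subseteq> supported {..k}" by (rule T_supported) auto
    show "T ` supported {..<k} \<subseteq> supported {..<k}" by (rule T_supported) auto
    show "clinear_on (?p ` supported {..k}) (D k)" unfolding img by (rule D_lin)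
  qed (rule pT)
  then show ?thesis unfolding img .
qed

text \<open>
  The additivity of the index, written without subtraction: it needs only the defects to be finite, and the
  nullities may be infinite.
\<close>

lemma index_formula:
  assumes fin: "\<And>s. diag_defect s \<noteq> \<infinity>"
  shows "nullity UNIV + (\<Sum>s\<in>UNIV. diag_defect s) = defect UNIV + (\<Sum>s\<in>UNIV. diag_nullity s)" and "defect UNIV \<le> (\<Sum>s\<in>UNIV. diag_defect s)"
proof -
  have main: "(\<forall>i\<in>S. \<forall>j<i. j \<in> S) \<longrightarrow>
     nullity S + (\<Sum>s\<in>S. diag_defect s) = defect S + (\<Sum>s\<in>S. diag_nullity s) \<and> defect S \<le> (\<Sum>s\<in>S. diag_defect s)" if "finite S" for S
    using that
  proof (induction S rule: finite_linorder_max_induct)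
    case empty
    have "supported {} = {0}" using complex_vector.subspace_0[OF sum_H] unfolding supported_def by (auto simp: vec_eq_iff)
    moreover have "T 0 = 0" using clinear_on_0[OF T_lin sum_H] .
    ultimately have "ker (supported {}) T = {0}" "T ` supported {} = {0}" "supported {} = {0}" by (auto simp: ker_def)
    then show ?case using codim_self[OF complex_vector.subspace_single_0] by simp
  next
    case (insert k S)
    show ?case
    proof
      assume down: "\<forall>i\<in>insert k S. \<forall>j<i. j \<in> insert k S"
      have S: "S = {..<k}" using insert.hyps down by auto
      have ins: "insert k S = {..k}" unfolding S by auto
      have "\<forall>i\<in>S. \<forall>j<i. j \<in> S" unfolding S by auto
      with insert.IH have IH: "nullity S + (\<Sum>s\<in>S. diag_defect s) = defect S + (\<Sum>s\<in>S. diag_nullity s)" "defect S \<le> (\<Sum>s\<in>S. diag_defect s)" by auto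
      have kS: "k \<notin> S" "finite S" unfolding S by auto
      obtain d c x where *: "nullity {..k} = nullity S + d" "diag_nullity k = d + c" "defect {..k} = x + diag_defect k" "defect S = x + c"
        using block_step[of k] unfolding S by blast
      have "nullity {..k} + (\<Sum>s\<in>insert k S. diag_defect s) = (nullity S + (\<Sum>s\<in>S. diag_defect s)) + d + diag_defect k"
        unfolding * using kS by (simp add: ac_simps)
      also have "\<dots> = (x + c) + (\<Sum>s\<in>S. diag_nullity s) + d + diag_defect k" unfolding IH(1) *(4) ..
      also have "\<dots> = defect {..k} + (\<Sum>s\<in>insert k S. diag_nullity s)"
        unfolding *(3) sum.insert[OF kS(2,1)] *(2) by (simp only: ac_simps)
      finally have 1: "nullity {..k} + (\<Sum>s\<in>insert k S. diag_defect s) = defect {..k} + (\<Sum>s\<in>insert k S. diag_nullity s)" .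
      have "x \<le> defect S" unfolding *(4) by simp
      then have "defect {..k} \<le> (\<Sum>s\<in>S. diag_defect s) + diag_defect k" unfolding *(3) using IH(2) by (intro add_right_mono) (rule order_trans)
      then have 2: "defect {..k} \<le> (\<Sum>s\<in>insert k S. diag_defect s)" using kS by (simp add: add.commute)
      show "nullity (insert k S) + (\<Sum>s\<in>insert k S. diag_defect s) = defect (insert k S) + (\<Sum>s\<in>insert k S. diag_nullity s)
        \<and> defect (insert k S) \<le> (\<Sum>s\<in>insert k S. diag_defect s)" using 1 2 unfolding ins by simp
    qed
  qed
  from main[of UNIV] show "nullity UNIV + (\<Sum>s\<in>UNIV. diag_defect s) = defect UNIV + (\<Sum>s\<in>UNIV. diag_nullity s)"
    "defect UNIV \<le> (\<Sum>s\<in>UNIV. diag_defect s)" by auto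
qed

lemma UNIV_atMost_last: "UNIV = {..last_idx :: 'n}"
  unfolding last_idx_def by auto

lemma last_defect_le: "diag_defect last_idx \<le> defect UNIV"
  using block_step[of last_idx] unfolding UNIV_atMost_last[symmetric] by auto

text \<open>
  The step from \<open>k\<close> to its predecessor increases the defect by at most \<open>\<alpha>(D k)\<close>, so a finite defect
  persists as long as no infinite-dimensional kernel is met.
\<close>

lemma defect_finite_descend:
  assumes fin: "defect UNIV \<noteq> \<infinity>" and al: "\<And>j. s < j \<Longrightarrow> diag_nullity j \<noteq> \<infinity>"
  shows "diag_defect s \<noteq> \<infinity>"
proof -
  \<comment> \<open>The least index from which a finite defect is known; it is \<open>s\<close>
    because the defect stays finite at its predecessor.\<close>
  define K where "K = {k. s \<le> k \<and> defect {..k} \<noteq> \<infinity>}"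
  have "defect {..last_idx} \<noteq> \<infinity>" using fin by (simp add: UNIV_atMost_last[symmetric])
  moreover have "s \<le> last_idx" unfolding last_idx_def by simp
  ultimately have "last_idx \<in> K" unfolding K_def by simp
  then have K: "Min K \<in> K" by (intro Min_in) auto
  have "Min K = s"
  proof (rule ccontr)
    define k where "k = Min K"
    assume "Min K \<noteq> s"
    then have sk: "s < k" "defect {..k} \<noteq> \<infinity>" using K unfolding k_def K_def by auto
    define l where "l = Max {..<k}"
    have l: "l \<in> {..<k}" unfolding l_def using sk by (intro Max_in) auto
    have "{..<k} = {..l}" using l by (auto simp: l_def)
    moreover obtain d c x where *: "diag_nullity k = d + c" "defect {..k} = x + diag_defect k" "defect {..<k} = x + c"
      using block_step[of k] by blast
    ultimately have "defect {..l} \<noteq> \<infinity>"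
      using sk(2) al[OF sk(1)] by (metis plus_eq_infty_iff_enat)
    moreover have "s \<le> l" using sk unfolding l_def by (intro Max_ge) auto
    ultimately have "l \<in> K" unfolding K_def by simp
    then have "k \<le> l" unfolding k_def by (intro Min_le) auto
    then show False using l by simp
  qed
  then have "defect {..s} \<noteq> \<infinity>" using K unfolding K_def by auto
  moreover obtain x where "defect {..s} = x + diag_defect s" using block_step[of s] by blast
  ultimately show ?thesis by (metis plus_eq_infty_iff_enat)
qed

lemma T_axis_nth:
  "T (axis s v) $ i = (if i = s then D s v else if i < s then A i s v else 0)"
proof -
  have "(\<Sum>j | i < j. A i j (axis s v $ j)) = (\<Sum>j | i < j. if j = s then A i s v else 0)"
    using A_0 by (intro sum.cong) (auto simp: axis_def)
  then show ?thesis unfolding T_nth using D_0 by (auto simp: axis_def sum.delta)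
qed

end

section \<open>Comparison of nullities and defects\<close>

lemma ind_nonneg_iff:
  assumes "card_enat (beta H T) \<noteq> \<infinity>"
  shows "ind H T \<ge> 0 \<longleftrightarrow> card_enat (beta H T) \<le> card_enat (alpha H T)"
  using assms unfolding ind_def ereal_of_card_eq
  by (cases "card_enat (beta H T)"; cases "card_enat (alpha H T)") (auto simp: ereal_of_enat_def)

lemma card_enat_card_sum: "card_enat (card_sum r) = (\<Sum>s\<in>UNIV. card_enat (r s))"
proof -
  have cs: "card_sum r = |SIGMA s : UNIV. Field (r s)|"
    unfolding card_sum_def BNF_Cardinal_Arithmetic.Csum_def by (simp add: Field_card_of)
  show ?thesis
  proof (cases "\<forall>s. finite (Field (r s))")
    case True
    have "(\<Sum>s\<in>S. enat (card (Field (r s)))) = enat (\<Sum>s\<in>S. card (Field (r s)))" if "finite S" for S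
      using that by (induction S rule: finite_induct) (auto simp: zero_enat_def)
    then show ?thesis
      unfolding cs card_enat_card_of using True
      by (simp add: finite_SigmaI card_SigmaI card_enat_def BNF_Cardinal_Arithmetic.cfinite_def)
  next
    case False
    then obtain s where s: "infinite (Field (r s))" by blast
    have "Pair s ` Field (r s) \<subseteq> (SIGMA s : UNIV. Field (r s))" by auto
    moreover have "infinite (Pair s ` Field (r s))" using s by (simp add: finite_image_iff inj_on_def)
    ultimately have "infinite (SIGMA s : UNIV. Field (r s))" using finite_subset by blast
    moreover have "card_enat (r s) \<le> (\<Sum>s\<in>UNIV. card_enat (r s))" by (intro member_le_sum) auto
    then have "(\<Sum>s\<in>UNIV. card_enat (r s)) = \<infinity>"
      using s by (simp add: card_enat_def BNF_Cardinal_Arithmetic.cfinite_def)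
    ultimately show ?thesis unfolding cs card_enat_card_of by simp
  qed
qed

lemma card_of_le_iff_card_enat:
  assumes "card_enat |X| \<noteq> \<infinity>"
  shows "|X| \<le>o |Y| \<longleftrightarrow> card_enat |X| \<le> card_enat |Y|"
proof -
  have X: "finite X" using assms by (simp add: card_enat_card_of split: if_splits)
  show ?thesis
  proof (cases "finite Y")
    case True
    then have "|X| \<le>o |Y| \<longleftrightarrow> card X \<le> card Y"
      using X card_of_ordLeq[of X Y] inj_on_iff_card_le[of X Y] by auto
    then show ?thesis using X True by (simp add: card_enat_card_of)
  next
    case False
    then have "|X| \<le>o |Y|"
      using X by (metis card_of_ordLeq_finite card_of_Well_order ordLeq_total)
    then show ?thesis using False by (simp add: card_enat_card_of)
  qed
qed

lemma card_sum_le_iff: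
  assumes "(\<Sum>s\<in>UNIV. card_enat (r s)) \<noteq> \<infinity>"
  shows "card_sum r \<le>o card_sum q \<longleftrightarrow> (\<Sum>s\<in>UNIV. card_enat (r s)) \<le> (\<Sum>s\<in>UNIV. card_enat (q s))"
  using card_of_le_iff_card_enat assms unfolding card_enat_card_sum[symmetric]
  unfolding card_sum_def BNF_Cardinal_Arithmetic.Csum_def by blast

context block_operator
begin

lemma card_alpha: "card_enat (alpha (H s) (D s)) = diag_nullity s"
  by (rule card_enat_alpha[OF D H])

lemma card_beta: "card_enat (beta (H s) (D s)) = diag_defect s"
  by (rule card_enat_beta[OF D H])

lemma T_Phi_iff: "T \<in> Phi_minus_plus (hilbert_sum H) \<longleftrightarrow> defect UNIV \<noteq> \<infinity> \<and> defect UNIV \<le> nullity UNIV"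
proof -
  have a: "card_enat (alpha (hilbert_sum H) T) = nullity UNIV"
    unfolding supported_UNIV by (rule card_enat_alpha[OF T_bounded hilbert_hilbert_sum[OF H]])
  have b: "card_enat (beta (hilbert_sum H) T) = defect UNIV"
    unfolding supported_UNIV by (rule card_enat_beta[OF T_bounded hilbert_hilbert_sum[OF H]])
  show ?thesis
    unfolding Phi_minus_plus_def Phi_minus_def
    using T_bounded ind_nonneg_iff[of "hilbert_sum H" T]
    by (auto simp: a b cfinite_iff simp del: not_infinity_eq)
qed

lemma D_Phi_iff: "D s \<in> Phi_minus (H s) \<longleftrightarrow> diag_defect s \<noteq> \<infinity>"
  unfolding Phi_minus_def using D[of s] by (simp add: cfinite_iff card_beta del: not_infinity_eq)

lemma sum_diag_defect_finite: "(\<forall>s. diag_defect s \<noteq> \<infinity>) \<Longrightarrow> (\<Sum>s\<in>UNIV. diag_defect s) \<noteq> \<infinity>"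
proof -
  assume fin: "\<forall>s. diag_defect s \<noteq> \<infinity>"
  have "(\<Sum>s\<in>S. diag_defect s) \<noteq> \<infinity>" if "finite S" for S
    using that by (induction S rule: finite_induct) (use fin in \<open>auto simp: plus_eq_infty_iff_enat simp del: not_infinity_eq\<close>)
  then show ?thesis by simp
qed

text \<open>
  By \<open>index_formula\<close> the index of \<open>T\<close> is determined by the diagonal.
\<close>

lemma T_Phi_iff_finite:
  assumes "\<And>s. diag_defect s \<noteq> \<infinity>"
  shows "T \<in> Phi_minus_plus (hilbert_sum H) \<longleftrightarrow> (\<Sum>s\<in>UNIV. diag_defect s) \<le> (\<Sum>s\<in>UNIV. diag_nullity s)"
proof -
  have fin: "(\<Sum>s\<in>UNIV. diag_defect s) \<noteq> \<infinity>" using sum_diag_defect_finite assms by blast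
  have "defect UNIV \<noteq> \<infinity>" using index_formula(2)[OF assms] fin by (metis enat_ord_simps(5))
  then show ?thesis
    unfolding T_Phi_iff using index_formula(1)[OF assms] fin
    by (cases "defect UNIV"; cases "nullity UNIV"; cases "\<Sum>s\<in>UNIV. diag_defect s"; cases "\<Sum>s\<in>UNIV. diag_nullity s") auto
qed

text \<open>
  If every diagonal defect is finite, the index decides. Otherwise an infinite-dimensional kernel must occur
  after the last infinite diagonal defect.
\<close>

lemma Phi_necessary:
  assumes T: "T \<in> Phi_minus_plus (hilbert_sum H)"
  shows "D last_idx \<in> Phi_minus (H last_idx)"
    and "(\<exists>j>first_idx. cinfinite (alpha (H j) (D j)) \<and>
            (\<forall>s. j \<le> s \<and> s < last_idx \<longrightarrow> cfinite (beta (H s) (D s))))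
         \<or> ((\<forall>s<last_idx. D s \<in> Phi_minus (H s)) \<and>
          card_sum (\<lambda>s. beta (H s) (D s)) \<le>o card_sum (\<lambda>s. alpha (H s) (D s)))"
proof -
  have fin: "defect UNIV \<noteq> \<infinity>" using T T_Phi_iff by blast
  have last: "diag_defect last_idx \<noteq> \<infinity>" using last_defect_le fin by (metis enat_ord_simps(5))
  then show "D last_idx \<in> Phi_minus (H last_idx)" using D_Phi_iff by blast
  show "(\<exists>j>first_idx. cinfinite (alpha (H j) (D j)) \<and>
            (\<forall>s. j \<le> s \<and> s < last_idx \<longrightarrow> cfinite (beta (H s) (D s))))
         \<or> ((\<forall>s<last_idx. D s \<in> Phi_minus (H s)) \<and>
          card_sum (\<lambda>s. beta (H s) (D s)) \<le>o card_sum (\<lambda>s. alpha (H s) (D s)))"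
  proof (cases "\<forall>s. diag_defect s \<noteq> \<infinity>")
    case True
    then have "card_sum (\<lambda>s. beta (H s) (D s)) \<le>o card_sum (\<lambda>s. alpha (H s) (D s))"
      using T T_Phi_iff_finite sum_diag_defect_finite
      by (subst card_sum_le_iff) (auto simp: card_alpha card_beta)
    then show ?thesis using True D_Phi_iff by blast
  next
    case False
    define s where "s = Max {s. diag_defect s = \<infinity>}"
    have "s \<in> {s. diag_defect s = \<infinity>}" unfolding s_def using False by (intro Max_in) auto
    then have s: "diag_defect s = \<infinity>" by simp
    have above: "diag_defect t \<noteq> \<infinity>" if "s < t" for t
    proof
      assume "diag_defect t = \<infinity>"
      then have "t \<le> s" unfolding s_def by (intro Max_ge) auto
      then show False using that by simp
    qed
    obtain j where j: "s < j" "diag_nullity j = \<infinity>" using defect_finite_descend[OF fin] s by blast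
    have "first_idx < j" using j(1) unfolding first_idx_def by (meson Min_le UNIV_I finite le_less_trans)
    moreover have "cinfinite (alpha (H j) (D j))"
      using j(2) card_alpha[of j] by (metis cfinite_iff BNF_Cardinal_Arithmetic.cfinite_def BNF_Cardinal_Arithmetic.cinfinite_def)
    moreover have "cfinite (beta (H t) (D t))" if "j \<le> t" for t
      using above[of t] j(1) that cfinite_iff card_beta[of t] by (metis less_le_trans)
    ultimately show ?thesis by blast
  qed
qed

end

section \<open>Construction of the entries above the diagonal\<close>

lemma next_idx_less:
  fixes s :: "'n::{finite,linorder}"
  assumes "s < last_idx" shows "s < next_idx s" and "s < t \<Longrightarrow> next_idx s \<le> t"
proof -
  have "next_idx s \<in> {t. s < t}" unfolding next_idx_def using assms by (intro Min_in) auto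
  then show "s < next_idx s" by simp
  show "s < t \<Longrightarrow> next_idx s \<le> t" unfolding next_idx_def by (intro Min_le) auto
qed

lemma next_idx_inj:
  fixes s :: "'n::{finite,linorder}"
  assumes "s < last_idx" "t < last_idx" "next_idx s = next_idx t" shows "s = t"
  using next_idx_less[OF assms(1)] next_idx_less[OF assms(2)] assms(3)
  by (metis leD linorder_less_linear)

lemma zero_bounded_ops:
  assumes "hilbert K" shows "(\<lambda>_. 0) \<in> bounded_ops H K"
  using assms complex_vector.subspace_0[of K] unfolding bounded_ops_def hilbert_def
  by (auto intro: exI[of _ 0])

lemma coisometry_between_defects:
  assumes H: "hilbert H" "hilbert K" and D: "D \<in> bounded_ops H H" and E: "E \<in> bounded_ops K K"
    and cl: "closed (D ` H)" and le: "beta H D \<le>o alpha K E"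
  shows "\<exists>A\<in>bounded_ops K H. A ` ker K E = orth_compl H (D ` H) \<and> (\<forall>x\<in>orth_compl K (ker K E). A x = 0)
    \<and> (cinfinite (alpha K E) \<longrightarrow> (\<exists>Z\<subseteq>ker K E. orthonormal Z \<and> infinite Z \<and> (\<forall>x\<in>Z. A x = 0)))"
proof -
  let ?N = "ker K E" and ?R = "orth_compl H (D ` H)"
  have N: "hilbert ?N" "?N \<subseteq> K" using hilbert_ker[OF E H(2)] by (auto simp: ker_def)
  have R: "hilbert ?R" "?R \<subseteq> H"
    by (rule hilbert_orth_compl[OF H(1)]) (auto simp: orth_compl_def)
  define C where "C = (SOME C. orthonormal_basis C ?N)"
  have C: "orthonormal_basis C ?N" unfolding C_def by (rule someI_ex[OF orthonormal_basis_exists[OF N(1)]])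
  define B where "B = (SOME B. orthonormal_basis B ?R)"
  have B: "orthonormal_basis B ?R" unfolding B_def by (rule someI_ex[OF orthonormal_basis_exists[OF R(1)]])
  have a: "alpha K E = |C|" unfolding alpha_def hilbert_dim_def C_def ..
  have b: "beta H D = |B|" unfolding beta_def hilbert_dim_def B_def using cl by simp
  have "\<exists>f. inj_on f B \<and> f ` B \<subseteq> C \<and> (infinite C \<longrightarrow> infinite (C - f ` B))"
    using injection_infinite_rest le unfolding a b by blast
  from coisometry_exists[OF H(2) N R(1) C B this]
  obtain A where A: "A \<in> bounded_ops K ?R" "A ` ?N = ?R" "\<forall>x\<in>orth_compl K ?N. A x = 0"
    "infinite C \<Longrightarrow> \<exists>Z\<subseteq>?N. orthonormal Z \<and> infinite Z \<and> (\<forall>x\<in>Z. A x = 0)" by blast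
  have "A \<in> bounded_ops K H" using A(1) R(2) unfolding bounded_ops_def by blast
  moreover have "cinfinite (alpha K E) \<Longrightarrow> infinite C"
    unfolding a BNF_Cardinal_Arithmetic.cinfinite_def by (simp add: Field_card_of)
  ultimately show ?thesis using A by blast
qed

text \<open>
  Only the entries next to the diagonal are nonzero. The partial isometry at \<open>(s, s + 1)\<close> maps the kernel of
  \<open>D (s + 1)\<close> onto the complement of the range of \<open>D s\<close> and vanishes on the complement of that kernel. So the two tasks of
  a component do not interfere: its part in the kernel of \<open>D (s + 1)\<close> fills the gap in summand \<open>s\<close>, its part
  orthogonal to the kernel produces the range of \<open>D (s + 1)\<close>.
\<close>

lemma Phi_sufficient_infinite:
  fixes H :: "'n::{finite,linorder} \<Rightarrow> 'a::chilbert_space set"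
  assumes H: "\<And>s. hilbert (H s)" and D: "\<And>s. D s \<in> bounded_ops (H s) (H s)"
    and last: "D last_idx \<in> Phi_minus (H last_idx)"
    and cl: "\<And>s. s < last_idx \<Longrightarrow> closed (D s ` H s)"
    and le: "\<And>s. s < last_idx \<Longrightarrow> beta (H s) (D s) \<le>o alpha (H (next_idx s)) (D (next_idx s))"
    and inf: "cinfinite (alpha (H k) (D k))"
  shows "\<exists>A\<in>block_tuples H. upper_tri D A \<in> Phi_minus_plus (hilbert_sum H)"
proof -
  let ?N = "\<lambda>s. ker (H s) (D s)"
  define Q where "Q s A \<longleftrightarrow> A \<in> bounded_ops (H (next_idx s)) (H s) \<and>
     A ` ?N (next_idx s) = orth_compl (H s) (D s ` H s) \<and>
     (\<forall>x\<in>orth_compl (H (next_idx s)) (?N (next_idx s)). A x = 0) \<and>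
     (cinfinite (alpha (H (next_idx s)) (D (next_idx s))) \<longrightarrow>
       (\<exists>Z\<subseteq>?N (next_idx s). orthonormal Z \<and> infinite Z \<and> (\<forall>x\<in>Z. A x = 0)))" for s A
  have "\<exists>A. Q s A" if "s < last_idx" for s
    using coisometry_between_defects[OF H H D D cl[OF that] le[OF that]] unfolding Q_def Bex_def .
  then obtain Co where Q: "\<And>s. s < last_idx \<Longrightarrow> Q s (Co s)" by metis
  have Co: "Co s \<in> bounded_ops (H (next_idx s)) (H s)"
     "Co s ` ?N (next_idx s) = orth_compl (H s) (D s ` H s)"
     "x \<in> orth_compl (H (next_idx s)) (?N (next_idx s)) \<Longrightarrow> Co s x = 0"
     "cinfinite (alpha (H (next_idx s)) (D (next_idx s))) \<Longrightarrow>
       \<exists>Z\<subseteq>?N (next_idx s). orthonormal Z \<and> infinite Z \<and> (\<forall>x\<in>Z. Co s x = 0)"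
    if "s < last_idx" for s x
    using Q[OF that] unfolding Q_def by simp_all
  define A where "A i j = (if i < last_idx \<and> j = next_idx i then Co i else (\<lambda>_. 0))" for i j
  have A: "A \<in> block_tuples H"
    unfolding block_tuples_def A_def using Co(1) zero_bounded_ops[OF H] by auto
  interpret block_operator H D A by unfold_locales (use H D A in auto)
  let ?V = "hilbert_sum H"
  have TV: "csubspace (T ` ?V)" using csubspace_image[OF T_lin sum_H] .
  have N: "hilbert (?N s)" "?N s \<subseteq> H s" for s using hilbert_ker[OF D H] by (auto simp: ker_def)
  \<comment> \<open>Summand \<open>s\<close> is hit by a vector with two components:
    \<open>u\<close> is orthogonal to the kernel of \<open>D s\<close>, hence invisible in the
    summand before \<open>s\<close>, and \<open>w\<close> lies in the kernel of the next diagonal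
    entry, hence invisible in its own summand.\<close>
  have hit: "axis s y \<in> T ` ?V" if s: "s < last_idx" and y: "y \<in> H s" for s y
  proof -
    let ?t = "next_idx s"
    have st: "s < ?t" using next_idx_less s by blast
    have "hilbert (D s ` H s)" using cl[OF s] csubspace_image[OF D_lin Hs] unfolding hilbert_def by blast
    from orth_decomp[OF this Hs bounded_ops_range[OF D] y]
    obtain z r where z: "z \<in> D s ` H s" "r \<in> orth_compl (H s) (D s ` H s)" "y = z + r" .
    then obtain u0 where u0: "u0 \<in> H s" "y = D s u0 + r" by blast
    have "r \<in> Co s ` ?N ?t" using Co(2)[OF s] z(2) by simp
    then obtain w where w: "w \<in> ?N ?t" "Co s w = r" by blast
    obtain n u where u: "n \<in> ?N s" "u \<in> orth_compl (H s) (?N s)" "u0 = n + u"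
      using orth_decomp[OF N(1) Hs N(2) u0(1)] .
    have mem: "n \<in> H s" "u \<in> H s" "w \<in> H ?t"
      using u(1,2) w(1) by (simp_all add: ker_def orth_compl_def)
    have Du: "D s u = D s u0" using clinear_on_add[OF D_lin mem(1,2)] u(1) unfolding u(3) ker_def by simp
    have "T (axis s u + axis ?t w) = T (axis s u) + T (axis ?t w)"
      using clinear_on_add[OF T_lin axis_in_sum[OF mem(2)] axis_in_sum[OF mem(3)]] .
    also have "\<dots> = axis s y"
    proof (rule vec_eq_iff[THEN iffD2], rule allI)
      fix i
      have 1: "T (axis s u) $ i = (if i = s then D s u0 else 0)"
        using Co(3)[of i u] u(2) Du unfolding T_axis_nth A_def by auto
      have 2: "T (axis ?t w) $ i = (if i = s then r else 0)"
        using w next_idx_inj[OF s, of i] s st unfolding T_axis_nth A_def ker_def by auto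
      show "(T (axis s u) + T (axis ?t w)) $ i = axis s y $ i"
        unfolding vector_add_component 1 2 using u0(2) by (simp add: axis_def)
    qed
    finally show ?thesis
      using complex_vector.subspace_add[OF sum_H axis_in_sum[OF mem(2)] axis_in_sum[OF mem(3)]] by force
  qed
  let ?p = "\<lambda>x :: ('a, 'n) vec. x $ last_idx"
  have p: "clinear_on ?V ?p" unfolding clinear_on_def by simp
  have kerp: "ker ?V ?p \<subseteq> T ` ?V"
  proof
    fix y assume y: "y \<in> ker ?V ?p"
    have "y = (\<Sum>s\<in>UNIV. axis s (y $ s))"
      by (simp add: vec_eq_iff axis_def sum.delta)
    moreover have "axis s (y $ s) \<in> T ` ?V" for s
    proof (cases "s = last_idx")
      case True
      then have "axis s (y $ s) = 0" using y by (simp add: ker_def axis_def vec_eq_iff)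
      with complex_vector.subspace_0[OF TV] show ?thesis by (simp only:)
    next
      case False
      have "s \<le> last_idx" unfolding last_idx_def by simp
      then show ?thesis using hit[of s] False y by (simp add: ker_def hilbert_sum_def)
    qed
    ultimately show "y \<in> T ` ?V" using complex_vector.subspace_sum[OF TV] by metis
  qed
  have "?p ` ?V = H last_idx"
  proof
    show "H last_idx \<subseteq> ?p ` ?V"
    proof
      fix y assume "y \<in> H last_idx"
      from axis_in_sum[OF this] show "y \<in> ?p ` ?V" by (intro image_eqI[of _ _ "axis last_idx y"]) (auto simp: axis_def)
    qed
  qed (auto simp: hilbert_sum_def)
  moreover have "T x $ last_idx = D last_idx (x $ last_idx)" for x
  proof -
    have "{j. last_idx < j} = ({} :: 'n set)" unfolding last_idx_def by (auto simp: not_less)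
    then show ?thesis unfolding T_nth by (simp only: sum.empty add_0_right)
  qed
  then have "?p ` T ` ?V = D last_idx ` ?p ` ?V" by (simp add: image_image)
  ultimately have "defect UNIV = diag_defect last_idx"
    unfolding supported_UNIV using codim_image[OF p sum_H TV bounded_ops_range[OF T_bounded] kerp] by simp
  then have fin: "defect UNIV \<noteq> \<infinity>" using last D_Phi_iff by simp
  \<comment> \<open>If \<open>k\<close> is the first index, no partial isometry acts on its summand,
    so the whole kernel of \<open>D k\<close> contributes to the kernel of \<open>T\<close>.\<close>
  have "\<exists>Z\<subseteq>?N k. orthonormal Z \<and> infinite Z \<and> (\<forall>x\<in>Z. T (axis k x) = 0)"
  proof (cases "\<exists>i<last_idx. next_idx i = k")
    case True
    then obtain i where i: "i < last_idx" "next_idx i = k" by blast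
    then obtain Z where Z: "Z \<subseteq> ?N k" "orthonormal Z" "infinite Z" "\<forall>x\<in>Z. Co i x = 0"
      using Co(4)[OF i(1)] inf by blast
    have "T (axis k x) = 0" if "x \<in> Z" for x
    proof (rule vec_eq_iff[THEN iffD2], rule allI)
      fix l
      have "A l k x = 0" using Z(4) that next_idx_inj[OF i(1), of l] i(2) unfolding A_def by auto
      then show "T (axis k x) $ l = 0 $ l" using Z(1) that unfolding T_axis_nth ker_def by auto
    qed
    then show ?thesis using Z by blast
  next
    case False
    define Z where "Z = (SOME Z. orthonormal_basis Z (?N k))"
    have "orthonormal_basis Z (?N k)" unfolding Z_def by (rule someI_ex[OF orthonormal_basis_exists[OF N(1)]])
    then have Z: "Z \<subseteq> ?N k" "orthonormal Z" unfolding orthonormal_basis_iff by auto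
    moreover have "infinite Z"
      using inf unfolding alpha_def hilbert_dim_def Z_def[symmetric] BNF_Cardinal_Arithmetic.cinfinite_def
      by (simp add: Field_card_of)
    moreover have "T (axis k x) = 0" if "x \<in> Z" for x
    proof (rule vec_eq_iff[THEN iffD2], rule allI)
      fix l
      have "A l k x = 0" using False unfolding A_def by auto
      then show "T (axis k x) $ l = 0 $ l" using Z(1) that unfolding T_axis_nth ker_def by auto
    qed
    ultimately show ?thesis by blast
  qed
  then obtain Z where Z: "Z \<subseteq> ?N k" "orthonormal Z" "infinite Z" "\<And>x. x \<in> Z \<Longrightarrow> T (axis k x) = 0" by blast
  have "orthonormal (axis k ` Z)"
  proof -
    have "cinner (axis k x) (axis k y) = cinner x y" for x y :: 'a
    proof -
      have "cinner (axis k x) (axis k y) = (\<Sum>i\<in>UNIV. if i = k then cinner x y else 0)"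
        unfolding cinner_vec_def by (intro sum.cong) (auto simp: axis_def)
      then show ?thesis by (simp add: sum.delta)
    qed
    then show ?thesis using Z(2) unfolding orthonormal_def by (simp add: axis_eq_axis)
  qed
  moreover have "axis k ` Z \<subseteq> ker (supported UNIV) T"
    using Z(1,4) N(2)[of k] axis_in_sum unfolding supported_UNIV by (auto simp: ker_def[of "hilbert_sum H"])
  moreover have "infinite (axis k ` Z)" using Z(3) by (simp add: finite_image_iff inj_on_def axis_eq_axis)
  moreover have "csubspace (ker (supported UNIV) T)" unfolding supported_UNIV using csubspace_ker[OF T_lin sum_H] .
  ultimately have "nullity UNIV = \<infinity>" using orthonormal_infinite_codim by blast
  then have "T \<in> Phi_minus_plus (hilbert_sum H)" unfolding T_Phi_iff using fin by simp
  then show ?thesis using A by blast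
qed

theorem theorem2p8:
  fixes H :: "'n::{finite,linorder} \<Rightarrow> 'a::chilbert_space set"
    and D :: "'n \<Rightarrow> 'a \<Rightarrow> 'a"
  assumes "CARD('n) \<ge> 2"
    and "\<And>s. hilbert (H s)"
    and "\<And>s. cinfinite (hilbert_dim (H s))"
    and "\<And>s. D s \<in> bounded_ops (H s) (H s)"
  shows
    "(D last_idx \<in> Phi_minus (H last_idx) \<and>
        (((\<forall>s<last_idx. closed (D s ` H s)) \<and>
          (\<forall>s<last_idx. beta (H s) (D s) \<le>o alpha (H (next_idx s)) (D (next_idx s))) \<and>
          cinfinite (card_sum (\<lambda>s. alpha (H s) (D s))))
         \<or>
         ((\<forall>s<last_idx. D s \<in> Phi_minus (H s)) \<and>
          card_sum (\<lambda>s. beta (H s) (D s)) \<le>o card_sum (\<lambda>s. alpha (H s) (D s))))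
      \<longrightarrow> (\<exists>A\<in>block_tuples H. upper_tri D A \<in> Phi_minus_plus (hilbert_sum H)))
     \<and>
     ((\<exists>A\<in>block_tuples H. upper_tri D A \<in> Phi_minus_plus (hilbert_sum H))
      \<longrightarrow> D last_idx \<in> Phi_minus (H last_idx) \<and>
        ((\<exists>j>first_idx. cinfinite (alpha (H j) (D j)) \<and>
            (\<forall>s. j \<le> s \<and> s < last_idx \<longrightarrow> cfinite (beta (H s) (D s))))
         \<or>
         ((\<forall>s<last_idx. D s \<in> Phi_minus (H s)) \<and>
          card_sum (\<lambda>s. beta (H s) (D s)) \<le>o card_sum (\<lambda>s. alpha (H s) (D s)))))"
proof (rule conjI; rule impI)
  assume "\<exists>A\<in>block_tuples H. upper_tri D A \<in> Phi_minus_plus (hilbert_sum H)"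
  then obtain A where *: "A \<in> block_tuples H" "upper_tri D A \<in> Phi_minus_plus (hilbert_sum H)" by blast
  interpret block_operator H D A by unfold_locales (use assms * in auto)
  show "D last_idx \<in> Phi_minus (H last_idx) \<and>
        ((\<exists>j>first_idx. cinfinite (alpha (H j) (D j)) \<and>
            (\<forall>s. j \<le> s \<and> s < last_idx \<longrightarrow> cfinite (beta (H s) (D s))))
         \<or>
         ((\<forall>s<last_idx. D s \<in> Phi_minus (H s)) \<and>
          card_sum (\<lambda>s. beta (H s) (D s)) \<le>o card_sum (\<lambda>s. alpha (H s) (D s))))"
    using Phi_necessary[OF *(2)] by (rule conjI)
next
  assume i: "D last_idx \<in> Phi_minus (H last_idx) \<and>
        (((\<forall>s<last_idx. closed (D s ` H s)) \<and>
          (\<forall>s<last_idx. beta (H s) (D s) \<le>o alpha (H (next_idx s)) (D (next_idx s))) \<and>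
          cinfinite (card_sum (\<lambda>s. alpha (H s) (D s))))
         \<or>
         ((\<forall>s<last_idx. D s \<in> Phi_minus (H s)) \<and>
          card_sum (\<lambda>s. beta (H s) (D s)) \<le>o card_sum (\<lambda>s. alpha (H s) (D s))))"
  \<comment> \<open>Witness for the second alternative, where membership in
    \<open>\<Phi>\<^sub>-\<^sup>+\<close> is decided by the diagonal.\<close>
  define A0 :: "'n \<Rightarrow> 'n \<Rightarrow> 'a \<Rightarrow> 'a" where "A0 = (\<lambda>_ _ _. 0)"
  have A0: "A0 \<in> block_tuples H" unfolding block_tuples_def A0_def using zero_bounded_ops assms(2) by blast
  interpret block_operator H D A0 by unfold_locales (use assms A0 in auto)
  from i consider
    (inf) "\<forall>s<last_idx. closed (D s ` H s)"
      "\<forall>s<last_idx. beta (H s) (D s) \<le>o alpha (H (next_idx s)) (D (next_idx s))"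
      "cinfinite (card_sum (\<lambda>s. alpha (H s) (D s)))"
    | (fin) "\<forall>s<last_idx. D s \<in> Phi_minus (H s)"
      "card_sum (\<lambda>s. beta (H s) (D s)) \<le>o card_sum (\<lambda>s. alpha (H s) (D s))" by blast
  then show "\<exists>A\<in>block_tuples H. upper_tri D A \<in> Phi_minus_plus (hilbert_sum H)"
  proof cases
    case inf
    have "\<exists>k. cinfinite (alpha (H k) (D k))"
    proof (rule ccontr)
      assume "\<not> ?thesis"
      then have "finite (Field (alpha (H k) (D k)))" for k
        unfolding BNF_Cardinal_Arithmetic.cinfinite_def by blast
      then have "finite (SIGMA k : UNIV. Field (alpha (H k) (D k)))" by (intro finite_SigmaI) auto
      then show False
        using inf(3) unfolding card_sum_def BNF_Cardinal_Arithmetic.Csum_def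
          BNF_Cardinal_Arithmetic.cinfinite_def by (simp add: Field_card_of)
    qed
    then show ?thesis using Phi_sufficient_infinite[of H D] assms i inf by blast
  next
    case fin
    have be: "diag_defect s \<noteq> \<infinity>" for s
    proof (cases "s = last_idx")
      case False
      have "s \<le> last_idx" unfolding last_idx_def by simp
      then show ?thesis using fin(1) D_Phi_iff False by simp
    qed (use i D_Phi_iff in blast)
    have "(\<Sum>s\<in>UNIV. diag_defect s) \<le> (\<Sum>s\<in>UNIV. diag_nullity s)"
      using fin(2) sum_diag_defect_finite be by (subst (asm) card_sum_le_iff) (auto simp: card_alpha card_beta)
    then have "upper_tri D A0 \<in> Phi_minus_plus (hilbert_sum H)" using T_Phi_iff_finite be by blast
    then show ?thesis using A0 by blast
  qed
qed

end
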